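(* Let $m,k\in\mathbb{N}$ with $k\ge2$, and let $T\subseteq\Sigma_m^*$ be a finite tree with $k$ terminal nodes $\tau_0,\dots,\tau_{k-1}$, associated pointed directed graph $\mathcal{G}=(G,v_1)$, induced length function $\ell=\ell_T$, and self-similar fractal tree $F_T$. Then the restriction of the Parry measure on the sofic shift $X_G$ with presentation $G$ to the path set determined by $\mathcal{G}$ is equal to the pushforward of $\mu_\ell$ under the function $\Psi_T:\Sigma_k^\infty\to F_T$ which maps coding sequences in $\Sigma_k^\infty$ to elements of $F_T$.
   Context: Logarithms are to base 2. $\Sigma_m=\{0,1,\dots,m-1\}$; $\Sigma_m^*$ is the set of finite strings and $\Sigma_m^\infty$ the set of infinite sequences over $\Sigma_m$; $|\sigma|$ is the number of symbols of $\sigma$. Trees. A tree is a subset of $\Sigma_m^*$ closed under taking initial segments. A finite tree $T$ is specified by a finite prefix-free set $S\subseteq\Sigma_m^*$ (no element is a proper initial segment of another), $T$ being the set of all initial segments of elements of $S$; the elements of $S$ are the terminal nodes of $T$ and the other elements of $T$ are its non-terminal nodes. A node $\sigma$ is the parent of $\tau$ if $\tau$ is $\sigma$ followed by exactly one symbol $a$; that edge of the tree then carries the label $a$. $T^*$ is the infinite tree obtained by recursively placing a copy of $T$ at each terminal node, i.e. the set of all initial segments of finite concatenations of terminal nodes of $T$, and $F_T=[T^*]$ is the set of $x\in\Sigma_m^\infty$ all of whose finite initial segments lie in $T^*$. The map $\Psi_T:\Sigma_k^\infty\to F_T$ sends $y$ to the infinite concatenation $\tau_{y(0)}\tau_{y(1)}\tau_{y(2)}\cdots$;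 it is a bijection, and $y$ is called the coding sequence of $\Psi_T(y)$. Length function and measure. $\ell_T:\Sigma_k\to\mathbb{N}$ is $\ell_T(i)=|\tau_i|$. The channel capacity of a length function $\ell:\Sigma_k\to\mathbb{N}$ is the unique real $\alpha\ge0$ with $\sum_{i=0}^{k-1}2^{-\alpha\ell(i)}=1$. With $r=2^{-\alpha}$, $\mu_\ell$ is the Bernoulli (product) probability measure on $\Sigma_k^\infty$ with $\mu_\ell(i)=r^{\ell(i)}$ for $i\in\Sigma_k$. Graph. Let $\sigma_1,\dots,\sigma_n$ be the non-terminal nodes of $T$ in length-lexicographic order, so that $\sigma_1$ is the root (the empty string). The labeled directed graph $G$ has vertices $v_1,\dots,v_n$, with distinguished vertex $v_1$. For each pair $i,j$ such that $\sigma_i$ is the parent of $\sigma_j$, there is one directed edge from $v_i$ to $v_j$, with the label of the tree edge from $\sigma_i$ to $\sigma_j$. For each $i$ and each terminal node $\tau$ whose parent is $\sigma_i$, there is one directed edge from $v_i$ to $v_1$, with the label of the tree edge from $\sigma_i$ to $\tau$. These are all the edges. The path set determined by $\mathcal{G}$ is the set of label sequences of one-sided infinite walks in $G$ starting at $v_1$; it equals $F_T$. The sofic shift $X_G$ with presentation $G$ is the one-sided shift closure of this path set, i.e. the set of label sequences of one-sided infinite walks in $G$ starting at any vertex. Parry measure. The Parry measure on $X_G$ is its unique measure of maximal entropy. Here a measure $\mu$ on the graph is given by initial probabilities $\mu(i(e))$ for the initial vertex $i(e)$ of each edge $e$ and conditional probabilities $\mu(e\mid i(e))$ for each edge $e$;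 its entropy is $h(\mu)=-\sum_{e}\mu(i(e))\,\mu(e\mid i(e))\log\mu(e\mid i(e))$, the sum being over all edges of $G$; and $\mu$ has maximal entropy if $h(\mu)$ equals the topological entropy $\limsup_{n\to\infty}\frac1n\log N_n$ of $X_G$, where $N_n$ is the number of distinct blocks of length $n$ occurring in elements of $X_G$. Explicitly, let $A$ be the adjacency matrix of $G$ ($(i,j)$ entry equal to the number of edges from $v_i$ to $v_j$), a non-negative irreducible matrix, let $\rho$ be its Perron eigenvalue (its spectral radius) and $(r_1,\dots,r_n)$ the corresponding right eigenvector; then under the Parry measure, given that a walk through $G$ is at $v_i$, each directed edge from $v_i$ to $v_j$ is traversed with probability $\frac{r_j}{r_i\rho}$.
   Formalization: "Restriction of the Parry measure to the path set" is read as the law of the label sequence of the Parry walk conditioned (normalised) on starting at v_1; literal restriction of the measure on X_G fails, e.g. for terminal nodes 0 and 10. *)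

theory Defs
  imports "HOL-Probability.Probability" "HOL-Library.Sublist" "Graph_Theory.Digraph"
begin

definition \<Sigma> :: "nat \<Rightarrow> nat set" where
  "\<Sigma> m = {0..<m}"

section \<open>Finite trees and self-similar fractal trees\<close>

definition prefix_free :: "'a list set \<Rightarrow> bool" where
  "prefix_free S \<longleftrightarrow> (\<forall>\<sigma>\<in>S. \<forall>\<tau>\<in>S. \<not> strict_prefix \<sigma> \<tau>)"

definition finite_tree :: "nat \<Rightarrow> nat list set \<Rightarrow> nat list set \<Rightarrow> bool" where
  "finite_tree m S T \<longleftrightarrow>
     finite S \<and> S \<subseteq> lists (\<Sigma> m) \<and> prefix_free S \<and> T = {\<sigma>. \<exists>\<tau>\<in>S. prefix \<sigma> \<tau>}"

text \<open>The infinite tree obtained by recursively placing a copy of the tree at each of its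
  terminal nodes, and its set of infinite branches.\<close>

definition recursive_tree :: "nat list set \<Rightarrow> nat list set" where
  "recursive_tree S = {\<sigma>. \<exists>ts\<in>lists S. prefix \<sigma> (concat ts)}"

definition fractal_tree :: "nat \<Rightarrow> nat list set \<Rightarrow> nat stream set" where
  "fractal_tree m S = {x \<in> streams (\<Sigma> m). \<forall>n. stake n x \<in> recursive_tree S}"

definition \<Psi> :: "(nat \<Rightarrow> nat list) \<Rightarrow> nat stream \<Rightarrow> nat stream" where
  "\<Psi> \<tau> y = flat (smap \<tau> y)"

section \<open>Length functions and their Bernoulli measures\<close>

definition channel_capacity :: "nat \<Rightarrow> (nat \<Rightarrow> nat) \<Rightarrow> real" where
  "channel_capacity k L =
     (THE \<alpha>. 0 \<le> \<alpha> \<and> (\<Sum>i\<in>\<Sigma> k. 2 powr (- \<alpha> * real (L i))) = 1)"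

definition length_measure :: "nat \<Rightarrow> (nat \<Rightarrow> nat) \<Rightarrow> nat stream measure" where
  "length_measure k L =
     (let r = 2 powr (- channel_capacity k L)
      in stream_space (point_measure (\<Sigma> k) (\<lambda>i. ennreal (r ^ L i))))"

section \<open>Labelled graphs: walks, path sets, sofic shifts\<close>

definition inf_walks :: "('v, 'e) pre_digraph \<Rightarrow> 'e stream set" where
  "inf_walks G =
     {\<omega> \<in> streams (arcs G). \<forall>n. head G (\<omega> !! n) = tail G (\<omega> !! Suc n)}"

definition inf_walks_from :: "('v, 'e) pre_digraph \<Rightarrow> 'v \<Rightarrow> 'e stream set" where
  "inf_walks_from G v = {\<omega> \<in> inf_walks G. tail G (shd \<omega>) = v}"

definition path_set :: "('v, 'e) pre_digraph \<Rightarrow> ('e \<Rightarrow> 'l) \<Rightarrow> 'v \<Rightarrow> 'l stream set" where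
  "path_set G lab v = smap lab ` inf_walks_from G v"

definition sofic_shift :: "('v, 'e) pre_digraph \<Rightarrow> ('e \<Rightarrow> 'l) \<Rightarrow> 'l stream set" where
  "sofic_shift G lab = (\<Union>v\<in>verts G. path_set G lab v)"

definition blocks :: "'l stream set \<Rightarrow> nat \<Rightarrow> 'l list set" where
  "blocks X n = {stake n (sdrop i x) | i x. x \<in> X}"

definition topological_entropy :: "'l stream set \<Rightarrow> ereal" where
  "topological_entropy X = limsup (\<lambda>n. ereal (log 2 (real (card (blocks X n))) / real n))"

section \<open>Measures on graphs and the Parry measure\<close>

text \<open>A measure on a graph is a pair of initial probabilities \<open>p\<close> of the vertices and
  conditional probabilities \<open>q\<close> of the edges given their initial vertices. Being a measure on
  a shift space it is shift invariant, which is the last clause. Both functions vanish off the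
  graph so that they are determined by their values on it.\<close>

definition graph_measure ::
    "('v, 'e) pre_digraph \<Rightarrow> ('v \<Rightarrow> real) \<Rightarrow> ('e \<Rightarrow> real) \<Rightarrow> bool" where
  "graph_measure G p q \<longleftrightarrow>
     (\<forall>v. 0 \<le> p v) \<and> (\<forall>v. v \<notin> verts G \<longrightarrow> p v = 0) \<and> (\<Sum>v\<in>verts G. p v) = 1 \<and>
     (\<forall>e. 0 \<le> q e) \<and> (\<forall>e. e \<notin> arcs G \<longrightarrow> q e = 0) \<and>
     (\<forall>v\<in>verts G. (\<Sum>e\<in>out_arcs G v. q e) = 1) \<and>
     (\<forall>v\<in>verts G. (\<Sum>e\<in>in_arcs G v. p (tail G e) * q e) = p v)"

definition graph_entropy ::
    "('v, 'e) pre_digraph \<Rightarrow> ('v \<Rightarrow> real) \<Rightarrow> ('e \<Rightarrow> real) \<Rightarrow> real" where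
  "graph_entropy G p q = - (\<Sum>e\<in>arcs G. p (tail G e) * q e * log 2 (q e))"

definition max_entropy ::
    "('v, 'e) pre_digraph \<Rightarrow> ('e \<Rightarrow> 'l) \<Rightarrow> ('v \<Rightarrow> real) \<Rightarrow> ('e \<Rightarrow> real) \<Rightarrow> bool" where
  "max_entropy G lab p q \<longleftrightarrow>
     graph_measure G p q \<and>
     ereal (graph_entropy G p q) = topological_entropy (sofic_shift G lab)"

definition parry ::
    "('v, 'e) pre_digraph \<Rightarrow> ('e \<Rightarrow> 'l) \<Rightarrow> ('v \<Rightarrow> real) \<times> ('e \<Rightarrow> real)" where
  "parry G lab = (THE (p, q). max_entropy G lab p q)"

text \<open>The law of the infinite walk: the measure on edge sequences, on the sigma-algebra
  generated by the cylinders, with the Markov values on cylinders.\<close>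

definition cylinder_prob ::
    "('v, 'e) pre_digraph \<Rightarrow> ('v \<Rightarrow> real) \<Rightarrow> ('e \<Rightarrow> real) \<Rightarrow> 'e list \<Rightarrow> real" where
  "cylinder_prob G p q es =
     (if successively (\<lambda>e f. head G e = tail G f) es
      then p (tail G (hd es)) * prod_list (map q es) else 0)"

definition walk_measure ::
    "('v, 'e) pre_digraph \<Rightarrow> ('v \<Rightarrow> real) \<times> ('e \<Rightarrow> real) \<Rightarrow> 'e stream measure" where
  "walk_measure G = (\<lambda>(p, q).
     extend_measure (streams (arcs G)) (lists (arcs G) - {[]})
       (\<lambda>es. {\<omega> \<in> streams (arcs G). stake (length es) \<omega> = es})
       (\<lambda>es. ennreal (cylinder_prob G p q es)))"

text \<open>Sequences over \<open>\<Sigma> m\<close> that lie in \<open>X\<close>, with the Borel (cylinder) sigma-algebra.\<close>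

definition seq_space :: "nat \<Rightarrow> nat stream set \<Rightarrow> nat stream measure" where
  "seq_space m X = restrict_space (stream_space (count_space (\<Sigma> m))) X"

text \<open>The restriction of the Parry measure to the path set of the pointed graph is the law of
  the label sequence of the walk given that it starts at the distinguished vertex \<open>v\<close>.
  The restriction has to be made on walks: conditioning the law of the labels on the event that
  the label sequence belongs to the path set would also count walks starting elsewhere that
  happen to have such a label sequence.\<close>

definition parry_path_set ::
    "nat \<Rightarrow> ('v, 'e) pre_digraph \<Rightarrow> ('e \<Rightarrow> nat) \<Rightarrow> 'v \<Rightarrow> nat stream measure" where
  "parry_path_set m G lab v =
     (let R = restrict_space (walk_measure G (parry G lab)) (inf_walks_from G v)
      in distr (uniform_measure R (space R)) (seq_space m (path_set G lab v)) (smap lab))"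

section \<open>The graph of a finite tree\<close>

text \<open>The vertex \<open>v\<^sub>i\<close> is the non-terminal node \<open>\<sigma>\<^sub>i\<close> itself, so the distinguished vertex is the
  empty string. The graph has exactly one edge for each edge of the tree, and a tree edge is
  named by its lower node \<open>\<sigma> \<noteq> []\<close>: it comes from the parent \<open>butlast \<sigma>\<close>, carries the label
  \<open>last \<sigma>\<close>, and is redirected to the root if \<open>\<sigma>\<close> is terminal.\<close>

definition tree_graph :: "nat list set \<Rightarrow> nat list set \<Rightarrow> (nat list, nat list) pre_digraph" where
  "tree_graph S T =
     \<lparr>verts = T - S, arcs = T - {[]}, tail = butlast, head = (\<lambda>\<sigma>. if \<sigma> \<in> S then [] else \<sigma>)\<rparr>"

abbreviation tree_label :: "nat list \<Rightarrow> nat" where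
  "tree_label \<equiv> last"

end

theory Submission
  imports Defs
begin

text \<open>Let \<open>\<alpha>\<close> be the channel capacity and \<open>r = 2\<^sup>-\<^sup>\<alpha>\<close>, so that the numbers \<open>r ^ length t\<close> for
terminal nodes \<open>t\<close> add up to 1, and give every node of the tree the mass \<open>\<Sum> r ^ length t\<close>, the sum
being over the terminal nodes \<open>t\<close> below it. This is the probability that a first codeword drawn
from the Bernoulli measure passes through the node. The masses of the children of a non-terminal
node add up to its own mass, so \<open>mass e / mass (parent of e)\<close> is a transition probability on the
edges of the graph. The walk with these transitions that starts at the root returns to it exactly
when it has spelled a codeword, and the successive codewords are independent with law \<open>r ^ length
t\<close>. Hence its law is the image of the Bernoulli measure under the map that writes out codewords as
walks (\<open>code_prob_path\<close>). What has to be shown is that this is the Parry chain, and that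
restricting the Parry measure to walks from the root means starting this chain there.

The first claim is Gibbs' inequality. Since \<open>mass t = r ^ length t\<close> for terminal \<open>t\<close> and the root
has mass 1, the function \<open>h v = ln (mass v) + ln 2 * \<alpha> * length v\<close> satisfies \<open>ln (edge_prob e) = h
(head e) - h (tail e) - ln 2 * \<alpha>\<close>, also for the edges that are redirected to the root. Averaged
over a stationary chain the two values of \<open>h\<close> cancel. Thus the entropy of any stationary chain is
\<open>\<alpha>\<close> minus an average of relative entropies (\<open>entropy_gap_identity\<close>). If it equals \<open>\<alpha>\<close>, the
transitions agree with \<open>edge_prob\<close> wherever the chain goes; as every vertex other than the root
has one incoming edge, stationarity then determines the vertex probabilities, too, and they are
positive (\<open>max_entropy_unique\<close>). The value \<open>\<alpha>\<close> is the topological entropy because every path of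
length \<open>n\<close> has probability \<open>r ^ n\<close> up to constant factors, and because a path is determined by its
labels once its first vertex is known (\<open>topological_entropy_tree\<close>).

For the second claim the stationary chain is built from the chain that starts at the root:
\<open>stationary_law B\<close> is proportional to the sum over all vertices \<open>v\<close> of the probability that the
latter chain first follows the branch from the root to \<open>v\<close> and then continues with an element of
\<open>B\<close>. On cylinders this gives the Markov probabilities, because \<open>vertex_prob\<close> is proportional to
\<open>mass\<close>, the probability of the branch. If \<open>B\<close> contains only walks from the root, just the term for
the root is left, so restriction followed by normalisation recovers the root chain
(\<open>conditioned_walk_law\<close>). Finally the two sides live on the same space because the path set is the
fractal tree, which rests on unique decoding of prefix-free codes (\<open>path_set_tree\<close>).\<close>

section \<open>Channel capacity, relative entropy and growth rates\<close>

text \<open>The defining sum is strictly decreasing in the exponent, is at least 1 at 0, and is at most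
1 at \<open>log 2 k\<close> because each length is positive. Hence the description in the definition of the
channel capacity denotes a number.\<close>

lemma channel_capacity_equation:
  assumes "k \<ge> 1" and "\<And>i. i < k \<Longrightarrow> L i \<ge> 1"
  shows "0 \<le> channel_capacity k L"
    and "(\<Sum>i\<in>\<Sigma> k. 2 powr (- channel_capacity k L * real (L i))) = 1"
proof -
  define f :: "real \<Rightarrow> real" where "f \<alpha> = (\<Sum>i\<in>\<Sigma> k. 2 powr (- \<alpha> * real (L i)))" for \<alpha>
  have anti: "f b < f a" if "a < b" for a b
    unfolding f_def
  proof (rule sum_strict_mono)
    show "\<Sigma> k \<noteq> {}" using assms(1) by (auto simp: \<Sigma>_def)
    fix i assume "i \<in> \<Sigma> k"
    then have "real (L i) > 0" using assms(2)[of i] by (auto simp: \<Sigma>_def)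
    then show "2 powr (- b * real (L i)) < 2 powr (- a * real (L i))"
      using that by simp
  qed (simp add: \<Sigma>_def)
  have "f (log 2 k) \<le> (\<Sum>i\<in>\<Sigma> k. 1 / real k)"
    unfolding f_def
  proof (rule sum_mono)
    fix i assume "i \<in> \<Sigma> k"
    then have "real (L i) \<ge> 1" using assms(2)[of i] by (auto simp: \<Sigma>_def)
    moreover have "log 2 k \<ge> 0" using assms(1) by simp
    ultimately have "log 2 k * 1 \<le> log 2 k * real (L i)" by (intro mult_left_mono) auto
    then have "2 powr (- log 2 k * real (L i)) \<le> 2 powr (- log 2 k)"
      by simp
    also have "\<dots> = 1 / k" using assms(1) by (simp add: powr_minus field_simps)
    finally show "2 powr (- log 2 k * real (L i)) \<le> 1 / real k" .
  qed
  also have "\<dots> = 1" using assms(1) by (simp add: \<Sigma>_def)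
  finally have "f (log 2 k) \<le> 1" .
  moreover have "1 \<le> f 0" using assms(1) by (simp add: f_def \<Sigma>_def)
  moreover have "\<forall>x. 0 \<le> x \<and> x \<le> log 2 k \<longrightarrow> isCont f x"
    unfolding f_def by (auto intro!: continuous_intros)
  moreover have "0 \<le> log 2 k" using assms(1) by simp
  ultimately have "\<exists>\<alpha>\<ge>0. \<alpha> \<le> log 2 k \<and> f \<alpha> = 1"
    using IVT2[of f "log 2 k" 1 0] by blast
  then obtain \<alpha> where \<alpha>: "0 \<le> \<alpha>" "f \<alpha> = 1" by auto
  have "\<beta> = \<alpha>" if "f \<beta> = 1" for \<beta>
    using anti[of \<alpha> \<beta>] anti[of \<beta> \<alpha>] that \<alpha>(2) by (cases \<alpha> \<beta> rule: linorder_cases) auto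
  then have "channel_capacity k L = \<alpha>"
    unfolding channel_capacity_def f_def[symmetric] using \<alpha> by (intro the_equality) blast+
  then show "0 \<le> channel_capacity k L"
    "(\<Sum>i\<in>\<Sigma> k. 2 powr (- channel_capacity k L * real (L i))) = 1"
    using \<alpha> by (auto simp: f_def)
qed

text \<open>Summed over probability vectors \<open>a\<close> and \<open>b\<close> this is the relative entropy of \<open>a\<close> with respect
to \<open>b\<close>; the linear terms, which then cancel, make each single summand non-negative.\<close>

definition entropy_gap :: "real \<Rightarrow> real \<Rightarrow> real" where
  "entropy_gap a b = a * (ln a - ln b) - a + b"

lemma entropy_gap_nonneg:
  assumes "0 \<le> a" "0 < b"
  shows "0 \<le> entropy_gap a b" and "entropy_gap a b = 0 \<longleftrightarrow> a = b"
proof -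
  have "0 \<le> entropy_gap a b \<and> (entropy_gap a b = 0 \<longleftrightarrow> a = b)"
  proof (cases "a = 0")
    case True
    then show ?thesis using assms by (simp add: entropy_gap_def)
  next
    case False
    with assms have a: "a > 0" by simp
    have eq: "entropy_gap a b = a * (b / a - 1 - ln (b / a))"
      using a assms by (simp add: entropy_gap_def ln_div field_simps)
    have "ln (b / a) \<le> b / a - 1" using a assms by (intro ln_le_minus_one) simp
    moreover have "b / a = 1" if "b / a - 1 - ln (b / a) = 0"
      using a assms ln_eq_minus_one[of "b / a"] that by simp
    moreover have "a = b" if "b / a = 1" using that a by simp
    ultimately show ?thesis unfolding eq using a by (auto intro: mult_nonneg_nonneg)
  qed
  then show "0 \<le> entropy_gap a b" "entropy_gap a b = 0 \<longleftrightarrow> a = b" by auto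
qed

lemma sum_arcs_by_tail:
  fixes f :: "'e \<Rightarrow> real"
  assumes "finite (arcs G)" "finite (verts G)" "\<And>e. e \<in> arcs G \<Longrightarrow> tail G e \<in> verts G"
  shows "(\<Sum>e\<in>arcs G. f e) = (\<Sum>v\<in>verts G. \<Sum>e\<in>out_arcs G v. f e)"
  unfolding out_arcs_def using assms by (intro sum.group[symmetric]) auto

lemma sum_arcs_by_head:
  fixes f :: "'e \<Rightarrow> real"
  assumes "finite (arcs G)" "finite (verts G)" "\<And>e. e \<in> arcs G \<Longrightarrow> head G e \<in> verts G"
  shows "(\<Sum>e\<in>arcs G. f e) = (\<Sum>v\<in>verts G. \<Sum>e\<in>in_arcs G v. f e)"
  unfolding in_arcs_def using assms by (intro sum.group[symmetric]) auto

lemma flat_unroll: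
  assumes "\<And>x. x \<in> sset s \<Longrightarrow> f x \<noteq> []"
  shows "flat (smap f s) = concat (map f (stake n s)) @- flat (smap f (sdrop n s))"
  using assms
proof (induction n arbitrary: s)
  case (Suc n)
  have "flat (smap f s) = f (shd s) @- flat (smap f (stl s))"
    using Suc.prems[OF shd_sset] by (simp add: flat_unfold)
  also have "flat (smap f (stl s)) = concat (map f (stake n (stl s))) @- flat (smap f (sdrop n (stl s)))"
    using Suc.prems by (intro Suc.IH) (metis stl_sset)
  finally show ?case by simp
qed simp

text \<open>Constant factors in an exponential bound disappear on the logarithmic scale.\<close>

lemma tendsto_log_growth_rate:
  fixes N :: "nat \<Rightarrow> real"
  assumes "c > 0" "C > 0"
    and bounds: "\<And>n. n \<ge> 1 \<Longrightarrow> c * 2 powr (a * real n) \<le> N n \<and> N n \<le> C * 2 powr (a * real n)"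
  shows "(\<lambda>n. log 2 (N n) / real n) \<longlonglongrightarrow> a"
proof (rule real_tendsto_sandwich)
  have bd: "log 2 c / n + a \<le> log 2 (N n) / n \<and> log 2 (N n) / n \<le> log 2 C / n + a" if n: "n \<ge> 1" for n
  proof -
    have "log 2 (x * 2 powr (a * real n)) = log 2 x + a * n" if "x > 0" for x
      using that by (simp add: log_mult)
    moreover have "0 < c * 2 powr (a * real n)" using assms(1) by simp
    ultimately have "log 2 c + a * n \<le> log 2 (N n)" "log 2 (N n) \<le> log 2 C + a * n"
      using bounds[OF n] assms(1,2) by (smt (verit) log_le_cancel_iff)+
    then have "(log 2 c + a * n) / n \<le> log 2 (N n) / n" "log 2 (N n) / n \<le> (log 2 C + a * n) / n"
      by (simp_all add: divide_right_mono)
    then show ?thesis using n by (simp add: add_divide_distrib)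
  qed
  show "\<forall>\<^sub>F n in sequentially. log 2 c / real n + a \<le> log 2 (N n) / real n"
    "\<forall>\<^sub>F n in sequentially. log 2 (N n) / real n \<le> log 2 C / real n + a"
    using bd by (auto intro: eventually_sequentiallyI[of 1])
  have "(\<lambda>n. x / real n + a) \<longlonglongrightarrow> a" for x
    using tendsto_add[OF lim_const_over_n[of x] tendsto_const[of a]] by simp
  then show "(\<lambda>n. log 2 c / real n + a) \<longlonglongrightarrow> a" "(\<lambda>n. log 2 C / real n + a) \<longlonglongrightarrow> a"
    by blast+
qed

lemma positive_bounds:
  fixes f :: "'b \<Rightarrow> real"
  assumes "finite A" "\<And>x. x \<in> A \<Longrightarrow> f x > 0"
  shows "\<exists>c>0. \<exists>C>0. \<forall>x\<in>A. c \<le> f x \<and> f x \<le> C"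
proof (intro exI conjI ballI)
  let ?c = "Min (insert 1 (f ` A))" and ?C = "Max (insert 1 (f ` A))"
  show "?c > 0" using assms by (subst Min_gr_iff) auto
  show "?C > 0" using assms by (subst Max_gr_iff) auto
  fix x assume "x \<in> A"
  then show "?c \<le> f x" "f x \<le> ?C" using assms(1) by (auto intro: Min_le Max_ge)
qed

section \<open>The tree and its graph\<close>

locale tree_code =
  fixes m k :: nat and S T :: "nat list set" and \<tau> :: "nat \<Rightarrow> nat list"
  assumes k_ge_2: "k \<ge> 2" and tree: "finite_tree m S T" and enum: "bij_betw \<tau> (\<Sigma> k) S"
begin

abbreviation G :: "(nat list, nat list) pre_digraph" where "G \<equiv> tree_graph S T"

lemma graph_simps [simp]:
  "verts G = T - S" "arcs G = T - {[]}" "tail G = butlast"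
  "head G e = (if e \<in> S then [] else e)"
  by (auto simp: tree_graph_def)

lemma finite_S [simp]: "finite S" and prefix_free_S: "prefix_free S"
  and T_eq: "T = {\<sigma>. \<exists>t\<in>S. prefix \<sigma> t}" and S_lists: "S \<subseteq> lists (\<Sigma> m)"
  using tree by (auto simp: finite_tree_def)

lemma finite_T [simp]: "finite T"
proof -
  have "T = (\<Union>t\<in>S. set (prefixes t))" by (auto simp: T_eq)
  then show ?thesis by simp
qed

lemma S_sub_T: "t \<in> S \<Longrightarrow> t \<in> T" by (auto simp: T_eq)

lemma T_prefix_closed: "\<sigma> \<in> T \<Longrightarrow> prefix \<rho> \<sigma> \<Longrightarrow> \<rho> \<in> T"
  unfolding T_eq using prefix_order.trans by blast

lemma T_lists: "\<sigma> \<in> T \<Longrightarrow> \<sigma> \<in> lists (\<Sigma> m)"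
proof -
  assume "\<sigma> \<in> T"
  then obtain t where "t \<in> S" "prefix \<sigma> t" by (auto simp: T_eq)
  then show ?thesis using S_lists set_mono_prefix[of \<sigma> t] by auto
qed

lemma prefix_freeD: "s \<in> S \<Longrightarrow> t \<in> S \<Longrightarrow> prefix s t \<Longrightarrow> s = t"
  using prefix_free_S by (auto simp: prefix_free_def strict_prefix_def)

text \<open>Every node of the tree has a terminal node below it, so a proper extension of a terminal
node inside the tree would contradict prefix-freeness.\<close>

lemma terminal_maximal: "s \<in> S \<Longrightarrow> \<sigma> \<in> T \<Longrightarrow> prefix s \<sigma> \<Longrightarrow> s = \<sigma>"
proof -
  assume *: "s \<in> S" "\<sigma> \<in> T" "prefix s \<sigma>"
  then obtain t where t: "t \<in> S" "prefix \<sigma> t" by (auto simp: T_eq)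
  then have "prefix s t" using *(3) prefix_order.trans by blast
  then have "s = t" using prefix_freeD * t by blast
  then show ?thesis using *(3) t(2) by (simp add: prefix_order.antisym)
qed

lemma root_nonterminal: "[] \<notin> S"
proof
  assume "[] \<in> S"
  then have "S = {[]}" using prefix_freeD[of "[]"] by auto
  then have "card S = 1" by simp
  moreover have "card S = k" using bij_betw_same_card[OF enum] by (simp add: \<Sigma>_def)
  ultimately show False using k_ge_2 by simp
qed

lemma S_nonempty: "S \<noteq> {}"
proof -
  have "\<tau> 0 \<in> S" using enum k_ge_2 by (auto simp: bij_betw_def \<Sigma>_def)
  then show ?thesis by auto
qed

lemma root_in_T [simp]: "[] \<in> T" using S_nonempty by (auto simp: T_eq)

lemma tail_in_verts:
  assumes "e \<in> T - {[]}"
  shows "butlast e \<in> T - S"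
proof -
  obtain v a where e: "e = v @ [a]" using assms by (cases e rule: rev_cases) auto
  have pre: "prefix v e" by (simp add: e)
  moreover have "e \<in> T" using assms by (rule DiffD1)
  ultimately have "v \<in> T" by (metis T_prefix_closed)
  moreover have "v \<notin> S"
  proof
    assume "v \<in> S"
    then have "v = e" using terminal_maximal \<open>e \<in> T\<close> pre by metis
    then show False by (simp add: e)
  qed
  ultimately show ?thesis by (simp add: e)
qed

lemma head_in_verts: "e \<in> T - {[]} \<Longrightarrow> head G e \<in> T - S"
  using root_nonterminal by simp

definition \<alpha> :: real where "\<alpha> = channel_capacity k (\<lambda>i. length (\<tau> i))"
definition r :: real where "r = 2 powr (- \<alpha>)"

lemma tau_in_S: "i < k \<Longrightarrow> \<tau> i \<in> S"
  using enum by (auto simp: bij_betw_def \<Sigma>_def)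

lemma tau_nonempty: "i < k \<Longrightarrow> \<tau> i \<noteq> []"
  using tau_in_S root_nonterminal by metis

lemma r_pos [simp]: "r > 0" and r_nonneg [simp]: "r \<ge> 0" and r_nonzero [simp]: "r \<noteq> 0"
  by (simp_all add: r_def)

lemma r_power_eq: "r ^ n = 2 powr (- \<alpha> * real n)"
proof -
  have "r ^ n = r powr real n" by (simp add: powr_realpow)
  then show ?thesis by (simp add: r_def powr_powr)
qed

lemma sum_r_tau: "(\<Sum>i\<in>\<Sigma> k. r ^ length (\<tau> i)) = 1"
proof -
  have "(\<Sum>i\<in>\<Sigma> k. 2 powr (- \<alpha> * real (length (\<tau> i)))) = 1"
    unfolding \<alpha>_def using k_ge_2 tau_nonempty
    by (intro channel_capacity_equation(2)) (auto simp: Suc_le_eq)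
  then show ?thesis by (simp only: r_power_eq)
qed

lemma sum_S_eq: "(\<Sum>t\<in>S. f t) = (\<Sum>i\<in>\<Sigma> k. f (\<tau> i))"
  by (rule sum.reindex_bij_betw[OF enum, symmetric])

section \<open>The Markov chain of the code\<close>

definition mass :: "nat list \<Rightarrow> real" where
  "mass \<sigma> = (\<Sum>t\<in>{t\<in>S. prefix \<sigma> t}. r ^ length t)"

lemma mass_pos: "\<sigma> \<in> T \<Longrightarrow> mass \<sigma> > 0"
  unfolding mass_def by (rule sum_pos) (auto simp: T_eq)

lemma mass_root: "mass [] = 1"
  by (simp add: mass_def sum_S_eq sum_r_tau)

lemma mass_terminal: "t \<in> S \<Longrightarrow> mass t = r ^ length t"
proof -
  assume "t \<in> S"
  then have "{s\<in>S. prefix t s} = {t}" using prefix_freeD by auto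
  then show ?thesis by (simp add: mass_def)
qed

text \<open>Each terminal node below a non-terminal \<open>v\<close> lies below exactly one child of \<open>v\<close>, namely its
own initial segment that is one symbol longer than \<open>v\<close>.\<close>

lemma mass_split:
  assumes "v \<in> T - S"
  shows "mass v = (\<Sum>e\<in>out_arcs G v. mass e)"
proof -
  have ext: "take (Suc (length v)) t \<in> out_arcs G v \<and> prefix v t"
    if "t \<in> S" "prefix v t" for t
  proof -
    have "v \<noteq> t" using assms that by auto
    then have "length v < length t"
      using that(2) by (metis le_neq_implies_less prefix_length_le prefix_order.dual_order.refl
          prefix_def append_eq_conv_conj take_all)
    then have "butlast (take (Suc (length v)) t) = v"
      using that by (auto simp: butlast_take prefix_def)
    moreover have "take (Suc (length v)) t \<in> T"
      using T_prefix_closed[OF S_sub_T take_is_prefix] that by blast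
    moreover have "take (Suc (length v)) t \<noteq> []" using \<open>length v < length t\<close> by auto
    ultimately show ?thesis using that by (simp add: out_arcs_def)
  qed
  have fib: "{t \<in> {t\<in>S. prefix v t}. take (Suc (length v)) t = e} = {t\<in>S. prefix e t}"
    if "e \<in> out_arcs G v" for e
  proof -
    have len: "length e = Suc (length v)" and "prefix v e"
      using that by (auto simp: out_arcs_def prefixeq_butlast)
    then have "take (Suc (length v)) t = e \<longleftrightarrow> prefix e t" for t
      using take_is_prefix[of "Suc (length v)" t] by (auto simp: prefix_def)
    moreover have "prefix e t \<Longrightarrow> prefix v t" for t
      using \<open>prefix v e\<close> prefix_order.trans by blast
    ultimately show ?thesis by blast
  qed
  have "mass v = (\<Sum>e\<in>out_arcs G v. \<Sum>t\<in>{t \<in> {t\<in>S. prefix v t}. take (Suc (length v)) t = e}. r ^ length t)"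
    unfolding mass_def using ext
    by (intro sum.group[symmetric]) (auto simp: out_arcs_def)
  also have "\<dots> = (\<Sum>e\<in>out_arcs G v. mass e)"
    unfolding mass_def using fib by (intro sum.cong) auto
  finally show ?thesis .
qed

definition edge_prob :: "nat list \<Rightarrow> real" where
  "edge_prob e = (if e \<in> T - {[]} then mass e / mass (butlast e) else 0)"

definition root_prob :: real where "root_prob = 1 / (\<Sum>v\<in>T - S. mass v)"

definition vertex_prob :: "nat list \<Rightarrow> real" where
  "vertex_prob v = (if v \<in> T - S then root_prob * mass v else 0)"

lemma root_prob_pos: "root_prob > 0"
proof -
  have "[] \<in> T - S" using root_nonterminal by simp
  then have "(\<Sum>v\<in>T - S. mass v) > 0"
    using mass_pos by (intro sum_pos2[of _ "[]"]) (auto intro: less_imp_le)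
  then show ?thesis by (simp add: root_prob_def)
qed

lemma edge_prob_pos: "e \<in> T - {[]} \<Longrightarrow> edge_prob e > 0"
  using tail_in_verts[of e] mass_pos by (auto simp: edge_prob_def)

lemma edge_prob_nonneg: "edge_prob e \<ge> 0"
  using edge_prob_pos[of e] by (cases "e \<in> T - {[]}") (auto simp: edge_prob_def)

lemma mass_step: "e \<in> T - {[]} \<Longrightarrow> mass (butlast e) * edge_prob e = mass e"
  using tail_in_verts[of e] mass_pos[of "butlast e"] by (auto simp: edge_prob_def)

lemma sum_edge_prob: "v \<in> T - S \<Longrightarrow> (\<Sum>e\<in>out_arcs G v. edge_prob e) = 1"
proof -
  assume v: "v \<in> T - S"
  have "(\<Sum>e\<in>out_arcs G v. edge_prob e) = (\<Sum>e\<in>out_arcs G v. mass e / mass v)"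
    by (intro sum.cong) (auto simp: out_arcs_def edge_prob_def)
  also have "\<dots> = 1" using mass_split[OF v] mass_pos[of v] v by (simp flip: sum_divide_distrib)
  finally show ?thesis .
qed

lemma in_arcs_root: "in_arcs G [] = S"
  using root_nonterminal S_sub_T by (auto simp: in_arcs_def)

lemma in_arcs_other: "v \<in> T - S \<Longrightarrow> v \<noteq> [] \<Longrightarrow> in_arcs G v = {v}"
  by (auto simp: in_arcs_def split: if_splits)

text \<open>Stationarity is immediate at a vertex other than the root, which has one incoming edge. At
the root it says that the masses of the terminal nodes add up to 1.\<close>

lemma graph_measure_tree: "graph_measure G vertex_prob edge_prob"
proof -
  have "(\<Sum>v\<in>T - S. mass v) > 0"
    using root_prob_pos by (simp add: root_prob_def)
  then have "(\<Sum>v\<in>T - S. vertex_prob v) = 1"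
    by (simp add: vertex_prob_def flip: sum_distrib_left) (simp add: root_prob_def)
  moreover have "(\<Sum>e\<in>in_arcs G v. vertex_prob (butlast e) * edge_prob e) = vertex_prob v" if v: "v \<in> T - S" for v
  proof -
    have *: "vertex_prob (butlast e) * edge_prob e = root_prob * mass e" if "e \<in> T - {[]}" for e
      using tail_in_verts[OF that] mass_step[OF that] by (simp add: vertex_prob_def mult.assoc)
    show ?thesis
    proof (cases "v = []")
      case True
      have "(\<Sum>e\<in>S. vertex_prob (butlast e) * edge_prob e) = (\<Sum>e\<in>S. root_prob * mass e)"
        using * S_sub_T root_nonterminal by (intro sum.cong) auto
      also have "\<dots> = root_prob * (\<Sum>i\<in>\<Sigma> k. r ^ length (\<tau> i))"
        by (simp add: mass_terminal sum_S_eq tau_in_S \<Sigma>_def flip: sum_distrib_left)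
      finally show ?thesis using True v by (simp add: sum_r_tau vertex_prob_def mass_root in_arcs_root)
    next
      case False
      then show ?thesis using v * by (simp add: in_arcs_other vertex_prob_def)
    qed
  qed
  ultimately show ?thesis
    using sum_edge_prob edge_prob_nonneg mass_pos root_prob_pos
    by (auto simp: graph_measure_def vertex_prob_def edge_prob_def less_imp_le)
qed

section \<open>Maximal entropy\<close>

text \<open>Gibbs' inequality in the form of an identity. The logarithms of the transition probabilities
differ from a constant only by the increments of a function \<open>h\<close> on the vertices, and such
increments have mean 0 under every stationary chain.\<close>

lemma entropy_gap_identity:
  assumes pq: "graph_measure G p q"
  shows "ln 2 * (\<alpha> - graph_entropy G p q) =
         (\<Sum>e\<in>arcs G. p (tail G e) * entropy_gap (q e) (edge_prob e))"
proof -
  have by_tail: "(\<Sum>e\<in>T - {[]}. f e) = (\<Sum>v\<in>T - S. \<Sum>e\<in>out_arcs G v. f e)" for f :: "nat list \<Rightarrow> real"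
    using sum_arcs_by_tail[of G f] tail_in_verts by auto
  have by_head: "(\<Sum>e\<in>T - {[]}. f e) = (\<Sum>v\<in>T - S. \<Sum>e\<in>in_arcs G v. f e)" for f :: "nat list \<Rightarrow> real"
    using sum_arcs_by_head[of G f] head_in_verts by auto
  define h where "h v = ln (mass v) + ln 2 * \<alpha> * real (length v)" for v
  have ln_trans: "ln (edge_prob e) = h (head G e) - h (tail G e) - ln 2 * \<alpha>" if e: "e \<in> T - {[]}" for e
  proof -
    have pos: "mass e > 0" "mass (butlast e) > 0" using e tail_in_verts[OF e] mass_pos by auto
    have len: "real (length (butlast e)) = real (length e) - 1"
      using e by (cases e) auto
    \<comment> \<open>The redirected edges are harmless: a terminal node \<open>e\<close> has \<open>h e = 0 = h []\<close> because \<open>mass e = r ^ length e\<close>.\<close>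
    have "h (head G e) = h e"
    proof (cases "e \<in> S")
      case True
      have "ln (mass e) = real (length e) * ln r" using True by (simp add: mass_terminal ln_realpow)
      also have "ln r = - ln 2 * \<alpha>" by (simp add: r_def ln_powr)
      finally show ?thesis using True by (simp add: h_def mass_root)
    qed simp
    moreover have "ln (edge_prob e) = ln (mass e) - ln (mass (butlast e))"
      using e pos by (simp add: edge_prob_def ln_div)
    ultimately show ?thesis using len by (simp add: h_def algebra_simps)
  qed
  have sum_pf: "(\<Sum>e\<in>T - {[]}. p (butlast e) * f e) = 1"
    if "\<And>v. v \<in> T - S \<Longrightarrow> (\<Sum>e\<in>out_arcs G v. f e) = 1" for f
  proof -
    have "(\<Sum>e\<in>T - {[]}. p (butlast e) * f e) = (\<Sum>v\<in>T - S. p v * (\<Sum>e\<in>out_arcs G v. f e))"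
      unfolding by_tail sum_distrib_left by (intro sum.cong) (auto simp: out_arcs_def)
    then show ?thesis using that pq by (simp add: graph_measure_def)
  qed
  have pq1: "(\<Sum>e\<in>T - {[]}. p (butlast e) * q e) = 1"
    using pq by (intro sum_pf) (auto simp: graph_measure_def)
  have flow: "(\<Sum>e\<in>T - {[]}. p (butlast e) * q e * h (head G e)) =
      (\<Sum>e\<in>T - {[]}. p (butlast e) * q e * h (butlast e))"
  proof -
    have "(\<Sum>e\<in>T - {[]}. p (butlast e) * q e * h (head G e)) =
       (\<Sum>v\<in>T - S. (\<Sum>e\<in>in_arcs G v. p (tail G e) * q e) * h v)"
      unfolding by_head sum_distrib_right by (intro sum.cong) (auto simp: in_arcs_def)
    also have "\<dots> = (\<Sum>v\<in>T - S. p v * (\<Sum>e\<in>out_arcs G v. q e) * h v)"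
      using pq by (intro sum.cong) (auto simp: graph_measure_def)
    also have "\<dots> = (\<Sum>e\<in>T - {[]}. p (butlast e) * q e * h (butlast e))"
      unfolding by_tail sum_distrib_right sum_distrib_left by (intro sum.cong) (auto simp: out_arcs_def)
    finally show ?thesis .
  qed
  have "(\<Sum>e\<in>T - {[]}. p (butlast e) * q e * ln (edge_prob e)) =
     (\<Sum>e\<in>T - {[]}. p (butlast e) * q e * h (head G e)) -
     (\<Sum>e\<in>T - {[]}. p (butlast e) * q e * h (butlast e)) -
     ln 2 * \<alpha> * (\<Sum>e\<in>T - {[]}. p (butlast e) * q e)"
    unfolding sum_distrib_left sum_subtractf[symmetric]
    by (intro sum.cong refl) (simp add: ln_trans algebra_simps del: graph_simps(4))
  then have cross: "(\<Sum>e\<in>T - {[]}. p (butlast e) * q e * ln (edge_prob e)) = - ln 2 * \<alpha>"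
    using flow pq1 by simp
  have "(\<Sum>e\<in>T - {[]}. p (butlast e) * entropy_gap (q e) (edge_prob e)) =
     (\<Sum>e\<in>T - {[]}. p (butlast e) * q e * ln (q e)) -
     (\<Sum>e\<in>T - {[]}. p (butlast e) * q e * ln (edge_prob e)) -
     (\<Sum>e\<in>T - {[]}. p (butlast e) * q e) + (\<Sum>e\<in>T - {[]}. p (butlast e) * edge_prob e)"
    unfolding sum_subtractf[symmetric] sum.distrib[symmetric]
    by (intro sum.cong refl) (simp add: entropy_gap_def algebra_simps)
  also have "\<dots> = (\<Sum>e\<in>T - {[]}. p (butlast e) * q e * ln (q e)) + ln 2 * \<alpha>"
    using sum_pf[of edge_prob, OF sum_edge_prob] pq1 cross by simp
  also have "(\<Sum>e\<in>T - {[]}. p (butlast e) * q e * ln (q e)) = - ln 2 * graph_entropy G p q"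
    by (simp add: graph_entropy_def log_def sum_distrib_left sum_negf)
  finally show ?thesis by (simp add: algebra_simps)
qed

lemma graph_entropy_tree: "graph_entropy G vertex_prob edge_prob = \<alpha>"
proof -
  have "entropy_gap (edge_prob e) (edge_prob e) = 0" for e by (simp add: entropy_gap_def)
  then show ?thesis using entropy_gap_identity[OF graph_measure_tree] by simp
qed

text \<open>Equality in Gibbs' inequality gives the right transitions out of all vertices of positive
probability. Going down the tree along the unique incoming edges, this propagates a multiple of
\<open>mass\<close> from the root to all vertices, and the normalisation fixes the multiple.\<close>

lemma max_entropy_unique:
  assumes pq: "graph_measure G p q" and h: "graph_entropy G p q = \<alpha>"
  shows "p = vertex_prob \<and> q = edge_prob"
proof -
  have p0: "p v \<ge> 0" and q0: "q v \<ge> 0" for v using pq by (auto simp: graph_measure_def)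
  have "(\<Sum>e\<in>arcs G. p (tail G e) * entropy_gap (q e) (edge_prob e)) = 0"
    using entropy_gap_identity[OF pq] h by simp
  then have "\<forall>e\<in>arcs G. p (tail G e) * entropy_gap (q e) (edge_prob e) = 0"
    using p0 q0 edge_prob_pos entropy_gap_nonneg(1)
    by (subst (asm) sum_nonneg_eq_0_iff) (auto intro!: mult_nonneg_nonneg)
  \<comment> \<open>Where the tail has probability 0 the identity says nothing about \<open>q\<close>.\<close>
  then have q_eq: "q e = edge_prob e" if "e \<in> T - {[]}" "p (butlast e) \<noteq> 0" for e
    using that q0 edge_prob_pos entropy_gap_nonneg(2) by auto
  have p_step: "p v = p (butlast v) * q v" if "v \<in> T - S" "v \<noteq> []" for v
    using pq that in_arcs_other[OF that] by (auto simp: graph_measure_def dest!: bspec[of _ _ v])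
  have p_eq: "p v = p [] * mass v" if "v \<in> T - S" for v
    using that
  proof (induction v rule: rev_induct)
    case Nil
    then show ?case by (simp add: mass_root)
  next
    case (snoc a v)
    have va: "v @ [a] \<in> T - {[]}" using snoc.prems by auto
    have v: "v \<in> T - S" using tail_in_verts[OF va] by simp
    have IH: "p v = p [] * mass v" using snoc.IH v by simp
    have "p (v @ [a]) = p v * q (v @ [a])" using p_step[OF snoc.prems] by simp
    also have "\<dots> = p v * edge_prob (v @ [a])" using q_eq[OF va] by (cases "p v = 0") auto
    also have "\<dots> = p [] * mass (v @ [a])" using mass_step[OF va] by (simp add: IH mult.assoc)
    finally show ?case .
  qed
  have "1 = (\<Sum>v\<in>T - S. p [] * mass v)" using pq p_eq by (simp add: graph_measure_def)
  then have root: "p [] = root_prob" 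
    by (simp add: root_prob_def flip: sum_distrib_left) (metis mult_zero_right nonzero_eq_divide_eq zero_neq_one)
  have p: "p v = vertex_prob v" for v
    using p_eq root pq by (cases "v \<in> T - S") (auto simp: vertex_prob_def graph_measure_def)
  have "q e = edge_prob e" for e
  proof (cases "e \<in> T - {[]}")
    case True
    then show ?thesis using q_eq[OF True] p_eq tail_in_verts[OF True] mass_pos[of "butlast e"] root root_prob_pos by auto
  next
    case False
    then show ?thesis using pq unfolding edge_prob_def graph_measure_def by auto
  qed
  with p show ?thesis by auto
qed

end

section \<open>Walks coded by sequences of terminal nodes\<close>

text \<open>An edge is named by its lower node, so this is the branch from the root to \<open>\<sigma>\<close> as a list of
edges.\<close>

definition edges :: "nat list \<Rightarrow> nat list list" where
  "edges \<sigma> = map (\<lambda>j. take (Suc j) \<sigma>) [0..<length \<sigma>]"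

lemma length_edges [simp]: "length (edges \<sigma>) = length \<sigma>"
  by (simp add: edges_def)

lemma edges_Nil [simp]: "edges [] = []"
  by (simp add: edges_def)

lemma edges_snoc [simp]: "edges (\<sigma> @ [a]) = edges \<sigma> @ [\<sigma> @ [a]]"
  by (simp add: edges_def)

lemma nth_edges: "j < length \<sigma> \<Longrightarrow> edges \<sigma> ! j = take (Suc j) \<sigma>"
  by (simp add: edges_def)

lemma map_last_edges [simp]: "map last (edges \<sigma>) = \<sigma>"
  by (induction \<sigma> rule: rev_induct) auto

lemma edges_eq_Nil_iff [simp]: "edges \<sigma> = [] \<longleftrightarrow> \<sigma> = []"
  by (simp add: edges_def)

lemma take_edges: "take n (edges \<sigma>) = edges (take n \<sigma>)"
  by (rule nth_equalityI) (auto simp: nth_edges min_absorb1 Suc_le_eq)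

context tree_code
begin

primrec path_from :: "nat list \<Rightarrow> nat list list \<Rightarrow> bool" where
  "path_from v [] \<longleftrightarrow> True"
| "path_from v (e # es) \<longleftrightarrow> e \<in> T - {[]} \<and> butlast e = v \<and> path_from (head G e) es"

definition coded_walk :: "nat stream \<Rightarrow> nat list stream" where
  "coded_walk y = flat (smap (edges \<circ> \<tau>) y)"

lemma codes_nonempty: "y \<in> streams (\<Sigma> k) \<Longrightarrow> i \<in> sset y \<Longrightarrow> \<tau> i \<noteq> []"
  using tau_nonempty by (auto simp: streams_iff_sset \<Sigma>_def)

lemma coded_walk_unroll:
  assumes "y \<in> streams (\<Sigma> k)"
  shows "coded_walk y = concat (map (edges \<circ> \<tau>) (stake n y)) @- coded_walk (sdrop n y)"
  unfolding coded_walk_def using codes_nonempty[OF assms] by (intro flat_unroll) auto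

lemma coded_walk_Stream:
  assumes "i < k"
  shows "coded_walk (i ## y) = edges (\<tau> i) @- coded_walk y"
  using tau_nonempty[OF assms] by (simp add: coded_walk_def)

lemma code_streamE:
  assumes "y \<in> streams (\<Sigma> k)"
  obtains i z where "y = i ## z" "i < k" "z \<in> streams (\<Sigma> k)"
proof -
  have "shd y < k" "stl y \<in> streams (\<Sigma> k)"
    using streams_shd[OF assms] streams_stl[OF assms] by (simp_all add: \<Sigma>_def)
  then show ?thesis using that[of "shd y" "stl y"] by simp
qed

text \<open>Codewords are non-empty, so the first \<open>Suc n\<close> of them contain the edge at position \<open>n\<close>. This
makes each coordinate of the coded walk a function of finitely many symbols, hence measurable.\<close>

lemma coded_walk_snth:
  assumes "y \<in> streams (\<Sigma> k)"
  shows "coded_walk y !! n = concat (map (edges \<circ> \<tau>) (stake (Suc n) y)) ! n"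
proof -
  have "j \<le> length (concat (map (edges \<circ> \<tau>) (stake j y)))" for j
    using assms
  proof (induction j arbitrary: y)
    case (Suc j)
    from Suc.prems obtain i z where y: "y = i ## z" "i < k" "z \<in> streams (\<Sigma> k)"
      by (rule code_streamE)
    have "length (\<tau> i) \<ge> 1" using tau_nonempty[OF y(2)] by (cases "\<tau> i") auto
    then show ?case using Suc.IH[OF y(3)] by (simp add: y)
  qed simp
  \<comment> \<open>The first \<open>Suc n\<close> codewords cover position \<open>n\<close>.\<close>
  from this[of "Suc n"] show ?thesis
    using coded_walk_unroll[OF assms, of "Suc n"] by (simp del: stake.simps)
qed

lemma coded_walk_is_walk:
  assumes "y \<in> streams (\<Sigma> k)"
  shows "coded_walk y \<in> inf_walks_from G []"
proof -
  have start: "butlast (coded_walk y !! 0) = []" if "y \<in> streams (\<Sigma> k)" for y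
  proof -
    from \<open>y \<in> streams (\<Sigma> k)\<close> obtain i z where y: "y = i ## z" "i < k" "z \<in> streams (\<Sigma> k)"
      by (rule code_streamE)
    then show ?thesis using tau_nonempty[OF y(2)] 
      by (cases "\<tau> i") (auto simp: coded_walk_Stream edges_def shift_snth upt_conv_Cons)
  qed
  have step: "coded_walk y !! n \<in> T - {[]} \<and> head G (coded_walk y !! n) = butlast (coded_walk y !! Suc n)"
    if "y \<in> streams (\<Sigma> k)" for n y
    using that
  proof (induction n arbitrary: y rule: less_induct)
    case (less n)
    obtain i z where y: "y = i ## z" and i: "i < k" and z: "z \<in> streams (\<Sigma> k)"
      using less.prems by (rule code_streamE)
    have S: "\<tau> i \<in> S" using tau_in_S[OF i] .
    have nth: "coded_walk y !! j =
        (if j < length (\<tau> i) then take (Suc j) (\<tau> i) else coded_walk z !! (j - length (\<tau> i)))" for j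
      using i by (simp add: y coded_walk_Stream shift_snth nth_edges)
    show ?case
    proof (cases "n < length (\<tau> i)")
      case True
      have in_T: "take (Suc n) (\<tau> i) \<in> T - {[]}"
        using T_prefix_closed[OF S_sub_T[OF S] take_is_prefix[of "Suc n"]] True by auto
      show ?thesis
      proof (cases "Suc n < length (\<tau> i)")
        case True
        have "take (Suc n) (\<tau> i) \<notin> S"
          using prefix_freeD[OF _ S take_is_prefix] True by fastforce
        moreover have "butlast (take (Suc (Suc n)) (\<tau> i)) = take (Suc n) (\<tau> i)"
          using True by (simp add: butlast_take)
        ultimately show ?thesis using True in_T by (simp add: nth del: snth.simps)
      next
        case False
        with True have "Suc n = length (\<tau> i)" by simp
        moreover from this have "take (Suc n) (\<tau> i) = \<tau> i" by simp
        ultimately show ?thesis using in_T S start[OF z] by (simp add: nth del: snth.simps)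
      qed
    next
      case False
      have "length (\<tau> i) > 0" using tau_nonempty[OF i] by simp
      then have "n - length (\<tau> i) < n" using False by arith
      from less.IH[OF this z] show ?thesis
        using False by (simp add: nth Suc_diff_le del: snth.simps)
    qed
  qed
  show ?thesis
    using start[OF assms] step[OF assms]
    by (auto simp: inf_walks_from_def inf_walks_def streams_iff_snth simp del: snth.simps(2))
qed

lemma smap_last_coded_walk:
  assumes "y \<in> streams (\<Sigma> k)"
  shows "smap last (coded_walk y) = \<Psi> \<tau> y"
proof -
  have "smap last (coded_walk y) !! n = \<Psi> \<tau> y !! n" if "y \<in> streams (\<Sigma> k)" for n y
    using that
  proof (induction n arbitrary: y rule: less_induct)
    case (less n)
    obtain i z where y: "y = i ## z" and i: "i < k" and z: "z \<in> streams (\<Sigma> k)"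
      using less.prems by (rule code_streamE)
    have "length (\<tau> i) > 0" using tau_nonempty[OF i] by simp
    then have "n - length (\<tau> i) < n" if "\<not> n < length (\<tau> i)" using that by arith
    moreover have "smap last (coded_walk y) = \<tau> i @- smap last (coded_walk z)"
      using i by (simp add: y coded_walk_Stream)
    moreover have "\<Psi> \<tau> y = \<tau> i @- \<Psi> \<tau> z"
      using tau_nonempty[OF i] by (simp add: \<Psi>_def y)
    ultimately show ?case using less.IH[OF _ z, of "n - length (\<tau> i)"]
      by (auto simp: shift_snth simp del: snth_smap)
  qed
  then have "(!!) (smap last (coded_walk y)) = (!!) (\<Psi> \<tau> y)" using assms by blast
  then show ?thesis by (metis stream_smap_nats)
qed

section \<open>The law of the coded walk\<close>

abbreviation code_measure :: "nat stream measure" where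
  "code_measure \<equiv> length_measure k (\<lambda>i. length (\<tau> i))"

abbreviation symbol_measure :: "nat measure" where
  "symbol_measure \<equiv> point_measure (\<Sigma> k) (\<lambda>i. ennreal (r ^ length (\<tau> i)))"

abbreviation walk_space :: "nat list stream measure" where
  "walk_space \<equiv> stream_space (count_space (T - {[]}))"

definition cyl :: "nat list list \<Rightarrow> nat list stream set" where
  "cyl es = {\<omega> \<in> streams (T - {[]}). stake (length es) \<omega> = es}"

lemma code_measure_eq: "code_measure = stream_space symbol_measure"
  by (simp add: length_measure_def Let_def r_def \<alpha>_def)

lemma finite_alphabet [simp]: "finite (\<Sigma> k)" by (simp add: \<Sigma>_def)

lemma prob_space_symbol_measure: "prob_space symbol_measure"
proof (rule prob_spaceI)
  have "emeasure symbol_measure (\<Sigma> k) = (\<Sum>i\<in>\<Sigma> k. ennreal (r ^ length (\<tau> i)))"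
    by (subst emeasure_point_measure_finite) auto
  also have "\<dots> = 1" using sum_r_tau by (simp add: sum_ennreal less_imp_le)
  finally show "emeasure symbol_measure (space symbol_measure) = 1"
    by (simp add: space_point_measure)
qed

lemma prob_space_code_measure: "prob_space code_measure"
  unfolding code_measure_eq by (rule prob_space.prob_space_stream_space[OF prob_space_symbol_measure])

lemma space_code_measure [simp]: "space code_measure = streams (\<Sigma> k)"
  by (simp add: code_measure_eq space_stream_space space_point_measure)

lemma measurable_coded_walk [measurable]: "coded_walk \<in> measurable code_measure walk_space"
proof (rule measurable_stream_space2)
  fix n
  have [measurable]: "(\<lambda>y. y) \<in> measurable code_measure (stream_space (count_space UNIV))"
  proof (rule measurable_stream_space2)
    fix n
    have "(\<lambda>i. i) \<in> measurable symbol_measure (count_space UNIV)"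
      by (simp add: measurable_point_measure_eq1)
    from measurable_compose[OF measurable_snth this]
    show "(\<lambda>y. y !! n) \<in> measurable code_measure (count_space UNIV)"
      by (simp add: code_measure_eq)
  qed
  have "(\<lambda>y. stake (Suc n) y) \<in> measurable code_measure (count_space UNIV)"
    by (rule measurable_compose[OF _ measurable_stake]) measurable
  from measurable_compose[OF this, of "\<lambda>xs. concat (map (edges \<circ> \<tau>) xs) ! n" "count_space UNIV"]
  have "(\<lambda>y. concat (map (edges \<circ> \<tau>) (stake (Suc n) y)) ! n) \<in> measurable code_measure (count_space UNIV)"
    by simp
  then have *: "(\<lambda>y. coded_walk y !! n) \<in> measurable code_measure (count_space UNIV)"
    by (subst measurable_cong[where g = "\<lambda>y. concat (map (edges \<circ> \<tau>) (stake (Suc n) y)) ! n"])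
       (simp_all add: coded_walk_snth del: stake.simps)
  show "(\<lambda>y. coded_walk y !! n) \<in> measurable code_measure (count_space (T - {[]}))"
  proof -
    have "countable (T - {[]})" by (rule countable_finite) simp
    moreover have "(\<lambda>y. coded_walk y !! n) -` {a} \<inter> space code_measure \<in> sets code_measure" for a
      using measurable_sets[OF *, of "{a}"] by simp
    moreover have "(\<lambda>y. coded_walk y !! n) \<in> space code_measure \<rightarrow> T - {[]}"
      using coded_walk_is_walk by (auto simp: inf_walks_from_def inf_walks_def streams_iff_snth simp del: snth.simps)
    ultimately show ?thesis by (subst measurable_count_space_eq2_countable) blast+
  qed
qed

lemma cyl_eq_sstart: "es \<in> lists (T - {[]}) \<Longrightarrow> cyl es = sstart (T - {[]}) es"
proof -
  assume es: "es \<in> lists (T - {[]})"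
  have "stake (length es) \<omega> = es \<longleftrightarrow> (\<forall>i<length es. \<omega> !! i = es ! i)" for \<omega>
    by (auto simp: list_eq_iff_nth_eq)
  then show ?thesis
    using sstart_eq[of _ "T - {[]}" es] sstart_in_streams[OF es] unfolding cyl_def by blast
qed

lemma cyl_sets: "es \<in> lists (T - {[]}) \<Longrightarrow> cyl es \<in> sets walk_space"
proof -
  assume es: "es \<in> lists (T - {[]})"
  have "countable (T - {[]})" by (rule countable_finite) simp
  moreover have "sstart (T - {[]}) ` lists (T - {[]}) \<union> {{}} \<subseteq> Pow (streams (T - {[]}))"
  proof (intro Un_least image_subsetI PowI)
    fix es assume "es \<in> lists (T - {[]})"
    then show "sstart (T - {[]}) es \<subseteq> streams (T - {[]})" by (rule sstart_in_streams)
  qed simp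
  ultimately have "sets walk_space = sigma_sets (streams (T - {[]})) (sstart (T - {[]}) ` lists (T - {[]}) \<union> {{}})"
    by (simp add: sets_stream_space_sstart)
  then show ?thesis using es by (auto simp: cyl_eq_sstart)
qed

definition code_prob :: "nat list list \<Rightarrow> ennreal" where
  "code_prob es = emeasure code_measure {y \<in> streams (\<Sigma> k). stake (length es) (coded_walk y) = es}"

lemma coded_walk_in_streams: "y \<in> streams (\<Sigma> k) \<Longrightarrow> coded_walk y \<in> streams (T - {[]})"
  using coded_walk_is_walk[of y] by (simp add: inf_walks_from_def inf_walks_def)

lemma code_prob_sets:
  assumes "es \<in> lists (T - {[]})"
  shows "{y \<in> streams (\<Sigma> k). stake (length es) (coded_walk y) = es} \<in> sets code_measure"
proof -
  have "{y \<in> streams (\<Sigma> k). stake (length es) (coded_walk y) = es} = coded_walk -` cyl es \<inter> space code_measure"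
    using coded_walk_in_streams by (auto simp: cyl_def)
  then show ?thesis using measurable_sets[OF measurable_coded_walk cyl_sets[OF assms]] by simp
qed

text \<open>The renewal equation of the coded walk: after the first codeword it starts afresh.\<close>

lemma code_prob_first_codeword:
  assumes "es \<in> lists (T - {[]})"
  shows "code_prob es = (\<Sum>i\<in>\<Sigma> k. ennreal (r ^ length (\<tau> i)) *
     emeasure code_measure {y \<in> streams (\<Sigma> k). stake (length es) (edges (\<tau> i) @- coded_walk y) = es})"
proof -
  define X where "X = {y \<in> streams (\<Sigma> k). stake (length es) (coded_walk y) = es}"
  have "code_prob es = (\<integral>\<^sup>+i. emeasure code_measure {y \<in> space code_measure. i ## y \<in> X} \<partial>symbol_measure)"
    unfolding code_prob_def X_def[symmetric] code_measure_eq
    by (rule prob_space.emeasure_stream_space[OF prob_space_symbol_measure])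
       (use code_prob_sets[OF assms] in \<open>simp add: X_def code_measure_eq\<close>)
  also have "\<dots> = (\<Sum>i\<in>\<Sigma> k. ennreal (r ^ length (\<tau> i)) * emeasure code_measure {y \<in> space code_measure. i ## y \<in> X})"
    by (rule nn_integral_point_measure_finite) simp
  also have "\<dots> = (\<Sum>i\<in>\<Sigma> k. ennreal (r ^ length (\<tau> i)) *
     emeasure code_measure {y \<in> streams (\<Sigma> k). stake (length es) (edges (\<tau> i) @- coded_walk y) = es})"
  proof (intro sum.cong refl)
    fix i assume i: "i \<in> \<Sigma> k"
    then have "coded_walk (i ## y) = edges (\<tau> i) @- coded_walk y" for y
      by (intro coded_walk_Stream) (simp add: \<Sigma>_def)
    then have "{y \<in> space code_measure. i ## y \<in> X} =
        {y \<in> streams (\<Sigma> k). stake (length es) (edges (\<tau> i) @- coded_walk y) = es}"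
      using i by (auto simp: X_def streams_Stream)
    then show "ennreal (r ^ length (\<tau> i)) * emeasure code_measure {y \<in> space code_measure. i ## y \<in> X} =
      ennreal (r ^ length (\<tau> i)) * emeasure code_measure
        {y \<in> streams (\<Sigma> k). stake (length es) (edges (\<tau> i) @- coded_walk y) = es}"
      by (simp only:)
  qed
  finally show ?thesis .
qed

lemma edges_in_lists: "v \<in> T \<Longrightarrow> edges v \<in> lists (T - {[]})"
  using T_prefix_closed[OF _ take_is_prefix] by (auto simp: edges_def)

lemma path_from_in_lists: "path_from v es \<Longrightarrow> es \<in> lists (T - {[]})"
  by (induction es arbitrary: v) auto

text \<open>Reading labels turns an equation between walks into one between strings, in which \<open>t\<close> and
\<open>v\<close> are both initial segments of the same string.\<close>

lemma codeword_comparable: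
  assumes "stake n (edges t @- w) = edges v @ es"
  shows "prefix t v \<or> prefix v t"
proof -
  have "map last (stake n (edges t @- w)) = v @ map last es"
    using assms by simp
  then have eq: "take n t @ stake (n - length t) (smap last w) = v @ map last es"
    by (simp add: stake_shift take_map[symmetric])
  show ?thesis
  proof (cases "n \<le> length t")
    case True
    then have "prefix v (take n t)" using eq by simp
    then show ?thesis using take_is_prefix prefix_order.trans by blast
  next
    case False
    then have "prefix t (v @ map last es)" using eq by (metis linear prefixI take_all)
    then show ?thesis using prefix_same_cases[of t "v @ map last es" v] by auto
  qed
qed

text \<open>The walk starts along the branch to \<open>v\<close> exactly if the first codeword extends \<open>v\<close>, as \<open>v\<close> is
non-terminal.\<close>

lemma code_prob_stem:
  assumes v: "v \<in> T - S"
  shows "code_prob (edges v) = ennreal (mass v)"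
proof -
  have *: "{y \<in> streams (\<Sigma> k). stake (length v) (edges (\<tau> i) @- coded_walk y) = edges v} =
      (if prefix v (\<tau> i) then space code_measure else {})" if i: "i \<in> \<Sigma> k" for i
  proof (cases "prefix v (\<tau> i)")
    case True
    then have "take (length v) (edges (\<tau> i)) = edges v" "length v \<le> length (\<tau> i)"
      by (auto simp: take_edges prefix_def)
    then show ?thesis using True by (simp add: stake_shift)
  next
    case False
    have "\<tau> i \<in> S" using i tau_in_S by (simp add: \<Sigma>_def)
    then have "\<not> prefix (\<tau> i) v" using terminal_maximal v by blast
    then have "stake (length v) (edges (\<tau> i) @- w) \<noteq> edges v" for w
      using False codeword_comparable[of "length v" "\<tau> i" w v "[]"] by auto
    then show ?thesis using False by simp
  qed
  have "code_prob (edges v) = (\<Sum>i\<in>\<Sigma> k. if prefix v (\<tau> i) then ennreal (r ^ length (\<tau> i)) else 0)"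
    unfolding code_prob_first_codeword[OF edges_in_lists[OF DiffD1[OF v]]] length_edges
    by (intro sum.cong refl) (auto simp: * prob_space.emeasure_space_1[OF prob_space_code_measure] simp del: space_code_measure)
  also have "\<dots> = (\<Sum>t\<in>S. if prefix v t then ennreal (r ^ length t) else 0)"
    using sum.reindex_bij_betw[OF enum, of "\<lambda>t. if prefix v t then ennreal (r ^ length t) else 0"] by simp
  also have "\<dots> = (\<Sum>t\<in>{t\<in>S. prefix v t}. ennreal (r ^ length t))"
    by (rule sum.inter_filter[symmetric]) simp
  also have "\<dots> = ennreal (mass v)"
    unfolding mass_def by (simp add: sum_ennreal less_imp_le)
  finally show ?thesis .
qed

text \<open>By prefix-freeness only one choice of the first codeword is compatible with the branch to a
terminal node.\<close>

lemma code_prob_codeword: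
  assumes t: "t \<in> S" and es: "es \<in> lists (T - {[]})"
  shows "code_prob (edges t @ es) = ennreal (r ^ length t) * code_prob es"
proof -
  obtain j where j: "j \<in> \<Sigma> k" "t = \<tau> j" using t enum by (auto simp: bij_betw_def)
  have *: "{y \<in> streams (\<Sigma> k). stake (length (edges t @ es)) (edges (\<tau> i) @- coded_walk y) = edges t @ es} =
      (if i = j then {y \<in> streams (\<Sigma> k). stake (length es) (coded_walk y) = es} else {})"
    if i: "i \<in> \<Sigma> k" for i
  proof (cases "i = j")
    case True
    then show ?thesis using j by (simp add: stake_shift)
  next
    case False
    have "\<tau> i \<in> S" using i tau_in_S by (simp add: \<Sigma>_def)
    moreover have "\<tau> i \<noteq> t" using enum i j False by (auto simp: bij_betw_def inj_on_def)
    ultimately have "\<not> prefix (\<tau> i) t" "\<not> prefix t (\<tau> i)" using t prefix_freeD by blast+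
    then have "stake (length (edges t @ es)) (edges (\<tau> i) @- w) \<noteq> edges t @ es" for w
      using codeword_comparable by blast
    then show ?thesis using False by simp
  qed
  have "edges t @ es \<in> lists (T - {[]})" using edges_in_lists[OF S_sub_T[OF t]] es by simp
  then have "code_prob (edges t @ es) = (\<Sum>i\<in>\<Sigma> k. if i = j then ennreal (r ^ length (\<tau> i)) * code_prob es else 0)"
    unfolding code_prob_first_codeword[OF \<open>edges t @ es \<in> lists (T - {[]})\<close>]
    by (intro sum.cong refl) (simp only: *, simp add: code_prob_def)
  also have "\<dots> = ennreal (r ^ length t) * code_prob es" using j by simp
  finally show ?thesis .
qed

lemma prod_edge_prob_nonneg: "prod_list (map edge_prob es) \<ge> 0"
  by (induction es) (auto intro: mult_nonneg_nonneg edge_prob_nonneg)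

text \<open>The coded walk is the Markov chain that starts at the root. The stem \<open>edges v\<close> records how
the walk came to the vertex \<open>v\<close> since its last visit to the root: an edge to a non-terminal node
lengthens the stem, and an edge to a terminal node completes a codeword, after which the renewal
equation removes it.\<close>

lemma code_prob_path:
  assumes "v \<in> T - S" "path_from v es"
  shows "code_prob (edges v @ es) = ennreal (mass v * prod_list (map edge_prob es))"
  using assms
proof (induction es arbitrary: v)
  case Nil
  then show ?case by (simp add: code_prob_stem)
next
  case (Cons e es)
  then have e: "e \<in> T - {[]}" "butlast e = v" and es: "path_from (head G e) es" by auto
  have "e = v @ [last e]" using e by (metis DiffD2 append_butlast_last_id singletonI)
  then have ed: "edges v @ e # es = edges e @ es" by (metis append.assoc append_Cons append_Nil edges_snoc)
  have st: "mass v * (edge_prob e * x) = mass e * x" for x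
    using mass_step[OF e(1)] by (simp add: e(2) mult.assoc[symmetric])
  show ?case
  proof (cases "e \<in> S")
    case True
    have "code_prob es = ennreal (prod_list (map edge_prob es))"
      using Cons.IH[of "[]"] True es root_nonterminal by (simp add: mass_root)
    then show ?thesis
      using True code_prob_codeword[OF True path_from_in_lists[OF es]]
      by (simp add: ed st mass_terminal ennreal_mult prod_edge_prob_nonneg less_imp_le[OF r_pos] del: graph_simps(4))
  next
    case False
    then show ?thesis using Cons.IH[of e] es e by (simp add: ed st)
  qed
qed

definition root_law :: "nat list stream measure" where
  "root_law = distr code_measure walk_space coded_walk"

lemma sets_root_law [simp, measurable_cong]: "sets root_law = sets walk_space"
  and space_root_law [simp]: "space root_law = streams (T - {[]})"
  by (simp_all add: root_law_def space_stream_space)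

lemma emeasure_root_law:
  assumes "B \<in> sets walk_space"
  shows "emeasure root_law B = emeasure code_measure {y \<in> streams (\<Sigma> k). coded_walk y \<in> B}"
  unfolding root_law_def using assms
  by (subst emeasure_distr) (auto intro!: arg_cong[of _ _ "emeasure code_measure"])

lemma emeasure_root_law_cyl:
  assumes "es \<in> lists (T - {[]})"
  shows "emeasure root_law (cyl es) = code_prob es"
  unfolding emeasure_root_law[OF cyl_sets[OF assms]] code_prob_def
  by (intro arg_cong[of _ _ "emeasure code_measure"]) (auto simp: cyl_def coded_walk_in_streams)

lemma walk_path_from:
  assumes "\<omega> \<in> inf_walks G"
  shows "path_from (butlast (shd \<omega>)) (stake n \<omega>)"
  using assms
proof (induction n arbitrary: \<omega>)
  case (Suc n)
  have "shd \<omega> \<in> T - {[]}" using Suc.prems streams_shd by (auto simp: inf_walks_def)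
  moreover have "stl \<omega> \<in> inf_walks G"
    using Suc.prems spec[of "\<lambda>n. head G (\<omega> !! n) = tail G (\<omega> !! Suc n)" "Suc _"]
    unfolding inf_walks_def by (simp add: streams_stl del: graph_simps)
  moreover have "head G (shd \<omega>) = butlast (shd (stl \<omega>))"
    using Suc.prems unfolding inf_walks_def by (auto dest: spec[of _ 0])
  ultimately show ?case using Suc.IH[of "stl \<omega>"] by simp
qed simp

text \<open>The branch to a non-terminal node \<open>v\<close> is a path that leads to the vertex \<open>v\<close>, since no edge
on it is redirected to the root.\<close>

lemma path_from_edges_append:
  assumes "path_from [] (edges v @ es)" "v \<in> T - S"
  shows "path_from v es"
  using assms
proof (induction v arbitrary: es rule: rev_induct)
  case (snoc a v)
  have "v @ [a] \<in> T - {[]}" using snoc.prems by simp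
  then have "v \<in> T - S" using tail_in_verts[of "v @ [a]"] by simp
  then have "path_from v ((v @ [a]) # es)" using snoc.prems(1) by (intro snoc.IH) simp_all
  then show ?case using snoc.prems(2) by simp
qed simp

lemma path_from_iff_successively:
  assumes "es \<in> lists (T - {[]})" "es \<noteq> []"
  shows "path_from v es \<longleftrightarrow> v = butlast (hd es) \<and> successively (\<lambda>e f. head G e = tail G f) es"
  using assms
proof (induction es arbitrary: v rule: list.induct)
  case (Cons e es)
  have e: "e \<in> T - {[]}" "es \<in> lists (T - {[]})" using Cons.prems(1) by simp_all
  show ?case
  proof (cases "es = []")
    case True
    then show ?thesis using e by auto
  next
    case False
    then show ?thesis using Cons.IH[OF e(2), of "head G e"] e
      by (auto simp: successively_Cons simp del: graph_simps(4))
  qed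
qed simp

lemma code_prob_stem_append:
  assumes "v \<in> T - S" "es \<in> lists (T - {[]})"
  shows "code_prob (edges v @ es) =
    (if path_from v es then ennreal (mass v * prod_list (map edge_prob es)) else 0)"
proof (cases "path_from v es")
  case True
  then show ?thesis using code_prob_path[OF assms(1)] by simp
next
  case False
  have "stake (length (edges v @ es)) (coded_walk y) \<noteq> edges v @ es" if y: "y \<in> streams (\<Sigma> k)" for y
  proof
    assume "stake (length (edges v @ es)) (coded_walk y) = edges v @ es"
    moreover have "path_from [] (stake (length (edges v @ es)) (coded_walk y))"
      using walk_path_from[of "coded_walk y"] coded_walk_is_walk[OF y]
      by (simp add: inf_walks_from_def del: stake.simps length_append)
    ultimately show False using False path_from_edges_append[OF _ assms(1)] by metis
  qed
  then have "{y \<in> streams (\<Sigma> k). stake (length (edges v @ es)) (coded_walk y) = edges v @ es} = {}"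
    by blast
  then show ?thesis using False by (simp only: code_prob_def emeasure_empty if_False)
qed

section \<open>The stationary law of the chain\<close>

text \<open>The size-biased version of the law from the root: a codeword is met with probability
proportional to its length times its probability, the walk sits at a uniformly chosen position
inside it, and \<open>v\<close> is the part of it that has been read already. The factor \<open>root_prob\<close> is the
reciprocal of the mean length of a codeword.\<close>

definition stationary_law :: "nat list stream set \<Rightarrow> ennreal" where
  "stationary_law B = ennreal root_prob * (\<Sum>v\<in>T - S. emeasure root_law
     {\<omega> \<in> streams (T - {[]}). stake (length v) \<omega> = edges v \<and> sdrop (length v) \<omega> \<in> B})"

lemma continuation_sets:
  assumes "v \<in> T - S" "B \<in> sets walk_space"
  shows "{\<omega> \<in> streams (T - {[]}). stake (length v) \<omega> = edges v \<and> sdrop (length v) \<omega> \<in> B} \<in> sets walk_space"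
proof -
  have "{\<omega> \<in> streams (T - {[]}). stake (length v) \<omega> = edges v \<and> sdrop (length v) \<omega> \<in> B} =
      cyl (edges v) \<inter> (sdrop (length v) -` B \<inter> space walk_space)"
    by (auto simp: cyl_def space_stream_space)
  moreover have "cyl (edges v) \<in> sets walk_space"
    using assms(1) by (intro cyl_sets edges_in_lists) simp
  ultimately show ?thesis using measurable_sets[OF measurable_sdrop assms(2)] by auto
qed

lemma stationary_law_positive: "positive (sets walk_space) stationary_law"
  by (simp add: positive_def stationary_law_def)

lemma stationary_law_countably_additive: "countably_additive (sets walk_space) stationary_law"
proof (rule countably_additiveI)
  fix A :: "nat \<Rightarrow> nat list stream set"
  assume A: "range A \<subseteq> sets walk_space" "disjoint_family A" "(\<Union>i. A i) \<in> sets walk_space"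
  define F where "F v B = {\<omega> \<in> streams (T - {[]}). stake (length v) \<omega> = edges v \<and> sdrop (length v) \<omega> \<in> B}" for v B
  have "(\<Sum>i. emeasure root_law (F v (A i))) = emeasure root_law (F v (\<Union>i. A i))" if v: "v \<in> T - S" for v
  proof -
    have "disjoint_family (\<lambda>i. F v (A i))"
      using A(2) unfolding disjoint_family_on_def F_def by blast
    moreover have "range (\<lambda>i. F v (A i)) \<subseteq> sets root_law"
      using A(1) continuation_sets[OF v] unfolding F_def by auto
    ultimately have "(\<Sum>i. emeasure root_law (F v (A i))) = emeasure root_law (\<Union>i. F v (A i))"
      by (intro suminf_emeasure) auto
    also have "(\<Union>i. F v (A i)) = F v (\<Union>i. A i)" by (auto simp: F_def)
    finally show ?thesis .
  qed
  then have "(\<Sum>v\<in>T - S. \<Sum>i. emeasure root_law (F v (A i))) = (\<Sum>v\<in>T - S. emeasure root_law (F v (\<Union>i. A i)))"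
    by (rule sum.cong[OF refl])
  moreover have "(\<Sum>v\<in>T - S. \<Sum>i. emeasure root_law (F v (A i))) = (\<Sum>i. \<Sum>v\<in>T - S. emeasure root_law (F v (A i)))"
    by (rule suminf_sum[symmetric]) simp
  ultimately show "(\<Sum>i. stationary_law (A i)) = stationary_law (\<Union>i. A i)"
    unfolding stationary_law_def F_def[symmetric] by simp
qed

lemma stationary_law_cyl_sum:
  assumes es: "es \<in> lists (T - {[]})"
  shows "stationary_law (cyl es) = ennreal root_prob * (\<Sum>v\<in>T - S. code_prob (edges v @ es))"
proof -
  have "emeasure root_law {\<omega> \<in> streams (T - {[]}). stake (length v) \<omega> = edges v \<and> sdrop (length v) \<omega> \<in> cyl es}
      = code_prob (edges v @ es)" if v: "v \<in> T - S" for v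
  proof -
    have "sdrop n \<omega> \<in> streams (T - {[]})" if "\<omega> \<in> streams (T - {[]})" for n \<omega>
      using that by (simp add: streams_iff_snth sdrop_snth)
    then have "{\<omega> \<in> streams (T - {[]}). stake (length v) \<omega> = edges v \<and> sdrop (length v) \<omega> \<in> cyl es} = cyl (edges v @ es)"
      unfolding cyl_def length_append length_edges stake_add[symmetric]
      by (auto simp del: stake_add)
    moreover have "edges v @ es \<in> lists (T - {[]})"
      using es edges_in_lists v by simp
    ultimately show ?thesis using emeasure_root_law_cyl by simp
  qed
  then show ?thesis by (simp add: stationary_law_def)
qed

text \<open>Only the vertex at which \<open>es\<close> starts contributes to the sum over \<open>v\<close>.\<close>

lemma stationary_law_cyl:
  assumes es: "es \<in> lists (T - {[]})" "es \<noteq> []"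
  shows "stationary_law (cyl es) = ennreal (cylinder_prob G vertex_prob edge_prob es)"
proof -
  define u where "u = butlast (hd es)"
  have u: "u \<in> T - S" unfolding u_def using es by (intro tail_in_verts) (cases es; simp)
  let ?succ = "successively (\<lambda>e f. head G e = tail G f) es"
  have iff: "path_from v es \<longleftrightarrow> v = u \<and> ?succ" for v
    using path_from_iff_successively[OF es, of v] by (simp add: u_def)
  have "(\<Sum>v\<in>T - S. code_prob (edges v @ es)) =
      (\<Sum>v\<in>T - S. if v = u then (if ?succ then ennreal (mass u * prod_list (map edge_prob es)) else 0) else 0)"
    using code_prob_stem_append[OF _ es(1)] iff by (intro sum.cong refl) (auto simp del: graph_simps(4))
  also have "\<dots> = (if ?succ then ennreal (mass u * prod_list (map edge_prob es)) else 0)"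
    using u by (subst sum.delta) auto
  finally have sum: "(\<Sum>v\<in>T - S. code_prob (edges v @ es)) =
      (if ?succ then ennreal (mass u * prod_list (map edge_prob es)) else 0)" .
  have "ennreal root_prob * ennreal (mass u * prod_list (map edge_prob es)) =
     ennreal (vertex_prob u * prod_list (map edge_prob es))"
    using u root_prob_pos mass_pos[of u] prod_edge_prob_nonneg[of es]
    by (simp add: vertex_prob_def mult.assoc less_imp_le flip: ennreal_mult)
  then show ?thesis
    unfolding stationary_law_cyl_sum[OF es(1)] sum cylinder_prob_def
    by (auto simp: u_def simp del: graph_simps(4))
qed

lemma stationary_law_space: "stationary_law (streams (T - {[]})) = 1"
proof -
  have "cyl [] = streams (T - {[]})" by (auto simp: cyl_def)
  then have "stationary_law (streams (T - {[]})) = ennreal root_prob * (\<Sum>v\<in>T - S. code_prob (edges v))"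
    using stationary_law_cyl_sum[of "[]"] by simp
  also have "\<dots> = ennreal root_prob * ennreal (\<Sum>v\<in>T - S. mass v)"
    by (subst sum_ennreal[symmetric])
       (auto simp: code_prob_stem intro: less_imp_le mass_pos)
  also have "\<dots> = ennreal (root_prob * (\<Sum>v\<in>T - S. mass v))"
    using mass_pos root_prob_pos by (intro ennreal_mult[symmetric] sum_nonneg) (auto intro: less_imp_le)
  also have "root_prob * (\<Sum>v\<in>T - S. mass v) = 1"
    using root_prob_pos by (simp add: root_prob_def)
  finally show ?thesis by simp
qed

abbreviation stationary_walk :: "nat list stream measure" where
  "stationary_walk \<equiv> walk_measure G (vertex_prob, edge_prob)"

lemma stationary_walk_eq_extend:
  "stationary_walk = extend_measure (streams (T - {[]})) (lists (T - {[]}) - {[]}) cyl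
     (\<lambda>es. ennreal (cylinder_prob G vertex_prob edge_prob es))"
  by (simp add: walk_measure_def cyl_def[abs_def])

lemma cyl_subset: "cyl es \<subseteq> streams (T - {[]})"
  by (auto simp: cyl_def)

lemma sets_walk_space: "sets walk_space = sigma_sets (streams (T - {[]})) (cyl ` lists (T - {[]}) \<union> {{}})"
proof -
  have "countable (T - {[]})" by (rule countable_finite) simp
  moreover have "sstart (T - {[]}) ` lists (T - {[]}) = cyl ` lists (T - {[]})"
    by (intro image_cong refl) (simp add: cyl_eq_sstart)
  moreover have "cyl ` lists (T - {[]}) \<union> {{}} \<subseteq> Pow (streams (T - {[]}))"
    using cyl_subset by auto
  ultimately show ?thesis by (simp add: sets_stream_space_sstart)
qed

lemma sets_stationary_walk [simp]: "sets stationary_walk = sets walk_space"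
proof -
  let ?E = "T - {[]}"
  have "cyl ` (lists ?E - {[]}) \<subseteq> Pow (streams ?E)" using cyl_subset by auto
  then have "sets stationary_walk = sigma_sets (streams ?E) (cyl ` (lists ?E - {[]}))"
    by (simp add: stationary_walk_eq_extend sets_extend_measure)
  also have "\<dots> = sigma_sets (streams ?E) (cyl ` lists ?E \<union> {{}})"
  proof (rule sigma_sets_eqI)
    fix a assume "a \<in> cyl ` (lists ?E - {[]})"
    then show "a \<in> sigma_sets (streams ?E) (cyl ` lists ?E \<union> {{}})" by (intro sigma_sets.Basic) auto
  next
    fix b assume "b \<in> cyl ` lists ?E \<union> {{}}"
    then consider "b = {}" | "b = cyl []" | "b \<in> cyl ` (lists ?E - {[]})" by blast
    then show "b \<in> sigma_sets (streams ?E) (cyl ` (lists ?E - {[]}))"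
    proof cases
      case 2
      then have "b = streams ?E" by (auto simp: cyl_def)
      then show ?thesis by (simp add: sigma_sets_top)
    qed (auto intro: sigma_sets.Empty sigma_sets.Basic)
  qed
  finally show ?thesis by (simp add: sets_walk_space)
qed

lemma space_stationary_walk [simp]: "space stationary_walk = streams (T - {[]})"
  using sets_eq_imp_space_eq[OF sets_stationary_walk] by (simp add: space_stream_space)

text \<open>The measure extending the Markov probabilities of cylinders exists because \<open>stationary_law\<close>
is one.\<close>

lemma emeasure_stationary_walk_cyl:
  assumes "es \<in> lists (T - {[]})" "es \<noteq> []"
  shows "emeasure stationary_walk (cyl es) = stationary_law (cyl es)"
  unfolding stationary_law_cyl[OF assms]
proof (rule emeasure_extend_measure[OF stationary_walk_eq_extend, of stationary_law])
  show "cyl ` (lists (T - {[]}) - {[]}) \<subseteq> Pow (streams (T - {[]}))" using cyl_subset by auto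
  show "positive (sets stationary_walk) stationary_law"
    using stationary_law_positive by simp
  show "countably_additive (sets stationary_walk) stationary_law"
    using stationary_law_countably_additive by simp
qed (use assms stationary_law_cyl in auto)

text \<open>The cylinders of non-empty words generate the \<open>\<sigma>\<close>-algebra and, with the empty set and the
whole space, are closed under intersection. The whole space is a finite disjoint union of
cylinders of length 1, so the extension is unique.\<close>

lemma emeasure_stationary_walk:
  assumes "B \<in> sets walk_space"
  shows "emeasure stationary_walk B = stationary_law B"
proof -
  let ?E = "T - {[]}"
  define N where "N = measure_of (streams ?E) (sets walk_space) stationary_law"
  have space: "space walk_space = streams ?E" by (simp add: space_stream_space)
  have sets_N: "sets N = sets walk_space"
    unfolding N_def using sets.sigma_sets_eq[of walk_space] sets.space_closed[of walk_space]
    by (simp add: space)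
  have N: "emeasure N X = stationary_law X" if "X \<in> sets walk_space" for X
    using that stationary_law_positive stationary_law_countably_additive sets.space_closed[of walk_space]
    by (intro emeasure_measure_of[OF N_def]) (simp_all add: sets_N space)
  have cover: "emeasure M (streams ?E) = (\<Sum>e\<in>?E. emeasure M (cyl [e]))" if M: "sets M = sets walk_space" for M
  proof -
    have "streams ?E = (\<Union>e\<in>?E. cyl [e])"
      using streams_shd by (fastforce simp: cyl_def)
    moreover have "disjoint_family_on (\<lambda>e. cyl [e]) ?E"
      by (auto simp: disjoint_family_on_def cyl_def)
    moreover have "(\<lambda>e. cyl [e]) ` ?E \<subseteq> sets M"
    proof (intro image_subsetI)
      fix e assume "e \<in> T - {[]}"
      then show "cyl [e] \<in> sets M" unfolding M by (intro cyl_sets) simp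
    qed
    ultimately show ?thesis by (simp add: sum_emeasure)
  qed
  have eq_cyl: "emeasure stationary_walk (cyl es) = emeasure N (cyl es)" if es: "es \<in> lists ?E" for es
  proof (cases "es = []")
    case False
    then show ?thesis using emeasure_stationary_walk_cyl[OF es] N[OF cyl_sets[OF es]] by simp
  next
    case True
    have "emeasure stationary_walk (cyl [e]) = emeasure N (cyl [e])" if "e \<in> ?E" for e
      using emeasure_stationary_walk_cyl[of "[e]"] N[OF cyl_sets[of "[e]"]] that by simp
    then have "emeasure stationary_walk (streams ?E) = emeasure N (streams ?E)"
      unfolding cover[OF sets_stationary_walk] cover[OF sets_N] by (intro sum.cong) auto
    then show ?thesis using True by (simp add: cyl_def)
  qed
  have "stationary_walk = N"
  proof (rule measure_eqI_generator_eq[where A = "\<lambda>_. streams ?E" and \<Omega> = "streams ?E"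
        and E = "cyl ` lists ?E \<union> {{}}"])
    have "cyl ` lists ?E = sstart ?E ` lists ?E"
      by (intro image_cong refl) (simp add: cyl_eq_sstart)
    then show "Int_stable (cyl ` lists ?E \<union> {{}})" using Int_stable_sstart by simp
    show "cyl ` lists ?E \<union> {{}} \<subseteq> Pow (streams ?E)" using cyl_subset by auto
    show "emeasure stationary_walk X = emeasure N X" if "X \<in> cyl ` lists ?E \<union> {{}}" for X
      using that eq_cyl by auto
    show "sets stationary_walk = sigma_sets (streams ?E) (cyl ` lists ?E \<union> {{}})"
      "sets N = sigma_sets (streams ?E) (cyl ` lists ?E \<union> {{}})"
      by (simp_all add: sets_N sets_walk_space)
    have top: "cyl [] = streams ?E" by (simp add: cyl_def)
    then have "streams ?E \<in> cyl ` lists ?E" by (metis imageI lists.Nil)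
    then show "range (\<lambda>_. streams ?E) \<subseteq> cyl ` lists ?E \<union> {{}}" by auto
    have "emeasure stationary_walk (streams ?E) = emeasure N (streams ?E)" using eq_cyl[of "[]"] top by simp
    also have "\<dots> = 1" using N[of "streams ?E"] stationary_law_space sets.top[of walk_space] by (simp add: space)
    finally show "emeasure stationary_walk (streams ?E) \<noteq> \<infinity>" by simp
  qed simp
  then show ?thesis using N[OF assms] by simp
qed

section \<open>Topological entropy\<close>

text \<open>The right Perron eigenvector of the adjacency matrix: at a vertex, \<open>scaled_mass\<close> is \<open>r\<close>
times the sum of its values at the ends of the outgoing edges, so the eigenvalue is \<open>1 / r\<close>.\<close>

definition scaled_mass :: "nat list \<Rightarrow> real" where
  "scaled_mass u = mass u / r ^ length u"

text \<open>Along a path the factors telescope and leave \<open>r\<close> to the number of edges and the eigenvector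
entry of the last vertex. The existential quantifier hides that vertex.\<close>

lemma path_mass:
  assumes "v \<in> T - S" "path_from v es"
  shows "\<exists>u\<in>T - S. mass v * prod_list (map edge_prob es) = r ^ (length v + length es) * scaled_mass u"
  using assms
proof (induction es arbitrary: v)
  case Nil
  then show ?case by (intro bexI[of _ v]) (simp_all add: scaled_mass_def)
next
  case (Cons e es)
  then have e: "e \<in> T - {[]}" "butlast e = v" and es: "path_from (head G e) es" by auto
  have len: "length e = Suc (length v)" using e by auto
  have eq: "mass v * prod_list (map edge_prob (e # es)) = mass e * prod_list (map edge_prob es)"
    using mass_step[OF e(1)] by (simp add: e(2) mult.assoc[symmetric])
  have IH: "\<exists>u\<in>T - S. mass (head G e) * prod_list (map edge_prob es) =
      r ^ (length (head G e) + length es) * scaled_mass u"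
    by (rule Cons.IH[OF head_in_verts[OF e(1)] es])
  show ?case
  proof (cases "e \<in> S")
    case True
    then show ?thesis using IH unfolding eq by (simp add: mass_root mass_terminal len power_add mult.assoc)
  next
    case False
    then show ?thesis using IH unfolding eq by (simp add: len)
  qed
qed

lemma scaled_mass_pos: "u \<in> T \<Longrightarrow> scaled_mass u > 0"
  using mass_pos by (simp add: scaled_mass_def)

text \<open>Distinct edges that leave the same vertex carry distinct labels.\<close>

lemma path_labels_inj:
  "path_from v es \<Longrightarrow> path_from v es' \<Longrightarrow> map last es = map last es' \<Longrightarrow> es = es'"
proof (induction es arbitrary: v es')
  case (Cons e es)
  then obtain e' fs where es': "es' = e' # fs" by (cases es') auto
  have "e = v @ [last e]" "e' = v @ [last e']"
    using Cons.prems es' append_butlast_last_id[of e] append_butlast_last_id[of e'] by simp_all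
  then have "e = e'" using Cons.prems es' by simp
  then show ?case using Cons.IH[of "head G e" fs] Cons.prems es' by simp
qed simp

lemma sdrop_inf_walks: "\<omega> \<in> inf_walks G \<Longrightarrow> sdrop i \<omega> \<in> inf_walks G"
  by (simp add: inf_walks_def streams_iff_snth sdrop_snth del: snth.simps graph_simps)

text \<open>The initial vertex is read off the first edge, so the definition is meaningful for \<open>n \<ge> 1\<close>
only.\<close>

definition paths :: "nat \<Rightarrow> nat list list set" where
  "paths n = {es \<in> lists (T - {[]}). length es = n \<and> path_from (butlast (hd es)) es}"

lemma finite_paths: "finite (paths n)"
proof (rule finite_subset)
  show "paths n \<subseteq> {es. set es \<subseteq> T - {[]} \<and> length es = n}" by (auto simp: paths_def)
  show "finite {es. set es \<subseteq> T - {[]} \<and> length es = n}" by (rule finite_lists_length_eq) simp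
qed

lemma blocks_subset:
  assumes "n \<ge> 1"
  shows "blocks (sofic_shift G last) n \<subseteq> map last ` paths n"
proof
  fix b assume "b \<in> blocks (sofic_shift G last) n"
  then obtain i \<omega> where b: "b = map last (stake n (sdrop i \<omega>))" and \<omega>: "\<omega> \<in> inf_walks G"
    by (auto simp: blocks_def sofic_shift_def path_set_def inf_walks_from_def)
  have "path_from (butlast (shd (sdrop i \<omega>))) (stake n (sdrop i \<omega>))"
    by (rule walk_path_from[OF sdrop_inf_walks[OF \<omega>]])
  moreover have "shd (sdrop i \<omega>) = hd (stake n (sdrop i \<omega>))"
    using assms by (cases n) auto
  ultimately have "stake n (sdrop i \<omega>) \<in> paths n"
    using path_from_in_lists by (simp add: paths_def)
  then show "b \<in> map last ` paths n" using b by blast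
qed

text \<open>The cylinders of the paths of length \<open>n\<close> are disjoint, and their probabilities are bounded
below by a multiple of \<open>r ^ n\<close>.\<close>

lemma card_paths_le:
  "\<exists>C>0. \<forall>n\<ge>1. real (card (paths n)) \<le> C * 2 powr (\<alpha> * real n)"
proof -
  obtain c where c: "c > 0" "\<And>u. u \<in> T \<Longrightarrow> c \<le> scaled_mass u"
    using positive_bounds[of T scaled_mass] scaled_mass_pos by auto
  obtain d where d: "d > 0" "\<And>v. v \<in> T \<Longrightarrow> d \<le> r ^ length v"
    using positive_bounds[of T "\<lambda>v. r ^ length v"] by auto
  \<comment> \<open>\<open>K * r ^ n\<close> bounds from below the probability of a path of length \<open>n\<close>; \<open>c\<close> and \<open>d\<close> account for its end and its start.\<close>
  define K where "K = root_prob * d * c"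
  have K: "K > 0" using root_prob_pos c d by (simp add: K_def)
  have "real (card (paths n)) \<le> 1 / K * 2 powr (\<alpha> * real n)" if n: "n \<ge> 1" for n
  proof -
    have lists: "es \<in> lists (T - {[]})" "es \<noteq> []" if "es \<in> paths n" for es
      using that n by (auto simp: paths_def)
    have ge: "ennreal (K * r ^ n) \<le> emeasure stationary_walk (cyl es)" if es: "es \<in> paths n" for es
    proof -
      define v where "v = butlast (hd es)"
      have v: "v \<in> T - S" unfolding v_def using lists[OF es] by (intro tail_in_verts) (cases es; simp)
      have path: "path_from v es" "length es = n" using es by (simp_all add: paths_def v_def)
      then obtain u where u: "u \<in> T - S" "mass v * prod_list (map edge_prob es) = r ^ (length v + n) * scaled_mass u"
        using path_mass[OF v] by auto
      have "K * r ^ n = root_prob * (d * (r ^ n * c))" by (simp add: K_def)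
      also have "\<dots> \<le> root_prob * (r ^ length v * (r ^ n * scaled_mass u))"
        using root_prob_pos c d v u(1) by (intro mult_left_mono mult_mono) (auto intro: less_imp_le)
      also have "\<dots> = vertex_prob v * prod_list (map edge_prob es)"
        using v u(2) by (simp add: vertex_prob_def mult.assoc power_add)
      also have "\<dots> = cylinder_prob G vertex_prob edge_prob es"
        using path path_from_iff_successively[OF lists[OF es], of v]
        by (simp add: cylinder_prob_def v_def del: graph_simps(4))
      finally have "K * r ^ n \<le> cylinder_prob G vertex_prob edge_prob es" .
      then show ?thesis
        using emeasure_stationary_walk_cyl[OF lists[OF es]] stationary_law_cyl[OF lists[OF es]]
        by (simp add: ennreal_leI)
    qed
    have disj: "disjoint_family_on cyl (paths n)"
      by (auto simp: disjoint_family_on_def cyl_def paths_def)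
    have "ennreal (real (card (paths n)) * (K * r ^ n)) = (\<Sum>es\<in>paths n. ennreal (K * r ^ n))"
      using K by (simp add: ennreal_mult ennreal_of_nat_eq_real_of_nat less_imp_le)
    also have "\<dots> \<le> (\<Sum>es\<in>paths n. emeasure stationary_walk (cyl es))"
      by (intro sum_mono ge)
    also have "\<dots> = emeasure stationary_walk (\<Union>es\<in>paths n. cyl es)"
      using cyl_sets lists(1) finite_paths disj by (intro sum_emeasure) auto
    also have "\<dots> \<le> emeasure stationary_walk (space stationary_walk)"
      by (rule emeasure_space)
    also have "\<dots> = 1"
      using emeasure_stationary_walk[of "streams (T - {[]})"] stationary_law_space
        sets.top[of walk_space] by (simp add: space_stream_space)
    finally have "real (card (paths n)) * (K * r ^ n) \<le> 1"
      using K by simp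
    then have "real (card (paths n)) * K \<le> 1 / r ^ n" by (simp add: field_simps)
    also have "1 / r ^ n = 2 powr (\<alpha> * n)" by (simp add: r_power_eq powr_minus field_simps)
    finally show ?thesis using K by (simp add: field_simps)
  qed
  then show ?thesis using K by (intro exI[of _ "1 / K"]) auto
qed

text \<open>The coded walk follows some path of length \<open>n\<close> from the root, each with probability at most
a multiple of \<open>r ^ n\<close>, so there are many of them; paths that start at the same vertex have
different label sequences.\<close>

lemma card_blocks_ge:
  "\<exists>c>0. \<forall>n\<ge>1. c * 2 powr (\<alpha> * real n) \<le> real (card (blocks (sofic_shift G last) n))"
proof -
  obtain C where C: "C > 0" "\<And>u. u \<in> T \<Longrightarrow> scaled_mass u \<le> C"
    using positive_bounds[of T scaled_mass] scaled_mass_pos by auto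
  have "1 / C * 2 powr (\<alpha> * real n) \<le> real (card (blocks (sofic_shift G last) n))" if n: "n \<ge> 1" for n
  proof -
    define B where "B = (\<lambda>y. stake n (coded_walk y)) ` streams (\<Sigma> k)"
    have path: "path_from [] es" "length es = n" if "es \<in> B" for es
    proof -
      obtain y where y: "y \<in> streams (\<Sigma> k)" "es = stake n (coded_walk y)"
        using \<open>es \<in> B\<close> by (auto simp: B_def)
      show "path_from [] es" "length es = n"
        using walk_path_from[of "coded_walk y" n] coded_walk_is_walk[OF y(1)]
        by (simp_all add: y(2) inf_walks_from_def)
    qed
    have lists: "es \<in> lists (T - {[]})" if "es \<in> B" for es
      using path_from_in_lists path(1)[OF that] .
    have fin: "finite B"
    proof (rule finite_subset)
      show "B \<subseteq> {es. set es \<subseteq> T - {[]} \<and> length es = n}" using path(2) lists by auto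
      show "finite {es. set es \<subseteq> T - {[]} \<and> length es = n}" by (rule finite_lists_length_eq) simp
    qed
    have le: "code_prob es \<le> ennreal (C * r ^ n)" if es: "es \<in> B" for es
    proof -
      have "code_prob es = ennreal (mass [] * prod_list (map edge_prob es))"
        using code_prob_path[of "[]" es] path(1)[OF es] root_nonterminal by simp
      moreover obtain u where "u \<in> T - S" "mass [] * prod_list (map edge_prob es) = r ^ n * scaled_mass u"
        using path_mass[of "[]" es] path[OF es] root_nonterminal by auto
      ultimately show ?thesis
        using C(2)[of u] by (simp add: mult.commute[of C] ennreal_leI mult_left_mono)
    qed
    have "streams (\<Sigma> k) = (\<Union>es\<in>B. {y \<in> streams (\<Sigma> k). stake (length es) (coded_walk y) = es})"
      using path(2) by (fastforce simp: B_def)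
    then have "emeasure code_measure (streams (\<Sigma> k)) =
        emeasure code_measure (\<Union>es\<in>B. {y \<in> streams (\<Sigma> k). stake (length es) (coded_walk y) = es})"
      by simp
    also have "\<dots> = (\<Sum>es\<in>B. code_prob es)"
      unfolding code_prob_def
    proof (rule sum_emeasure[symmetric])
      show "(\<lambda>es. {y \<in> streams (\<Sigma> k). stake (length es) (coded_walk y) = es}) ` B \<subseteq> sets code_measure"
        using code_prob_sets[OF lists] by (rule image_subsetI)
    qed (use fin path(2) in \<open>auto simp: disjoint_family_on_def\<close>)
    also have "\<dots> \<le> (\<Sum>es\<in>B. ennreal (C * r ^ n))" by (intro sum_mono le)
    also have "\<dots> = ennreal (real (card B) * (C * r ^ n))"
      using C(1) by (simp add: ennreal_mult ennreal_of_nat_eq_real_of_nat less_imp_le)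
    finally have "1 \<le> real (card B) * (C * r ^ n)"
      using prob_space.emeasure_space_1[OF prob_space_code_measure] by simp
    then have "1 / r ^ n \<le> real (card B) * C" by (simp add: field_simps)
    also have "1 / r ^ n = 2 powr (\<alpha> * n)" by (simp add: r_power_eq powr_minus field_simps)
    finally have *: "1 / C * 2 powr (\<alpha> * n) \<le> real (card B)" using C by (simp add: field_simps)
    have "card B = card (map last ` B)"
      using path_labels_inj path(1) by (intro card_image[symmetric]) (auto simp: inj_on_def)
    also have "\<dots> \<le> card (blocks (sofic_shift G last) n)"
    proof (rule card_mono)
      show "finite (blocks (sofic_shift G last) n)"
        using blocks_subset[OF n] finite_paths by (meson finite_imageI finite_subset)
      show "map last ` B \<subseteq> blocks (sofic_shift G last) n"
      proof
        fix b assume "b \<in> map last ` B"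
        then obtain y where y: "y \<in> streams (\<Sigma> k)" "b = stake n (sdrop 0 (smap last (coded_walk y)))"
          by (auto simp: B_def)
        have "smap last (coded_walk y) \<in> sofic_shift G last"
          unfolding sofic_shift_def path_set_def
          using coded_walk_is_walk[OF y(1)] root_nonterminal by (intro UN_I[of "[]"]) auto
        then show "b \<in> blocks (sofic_shift G last) n" using y(2) unfolding blocks_def by blast
      qed
    qed
    finally show ?thesis using * by simp
  qed
  then show ?thesis using C(1) by (intro exI[of _ "1 / C"]) auto
qed

lemma topological_entropy_tree: "topological_entropy (sofic_shift G last) = ereal \<alpha>"
proof -
  let ?N = "\<lambda>n. real (card (blocks (sofic_shift G last) n))"
  obtain C where C: "C > 0" "\<And>n. n \<ge> 1 \<Longrightarrow> real (card (paths n)) \<le> C * 2 powr (\<alpha> * real n)"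
    using card_paths_le by auto
  obtain c where c: "c > 0" "\<And>n. n \<ge> 1 \<Longrightarrow> c * 2 powr (\<alpha> * real n) \<le> ?N n"
    using card_blocks_ge by auto
  have "?N n \<le> C * 2 powr (\<alpha> * real n)" if "n \<ge> 1" for n
    using surj_card_le[OF finite_paths blocks_subset[OF that]] C(2)[OF that] by linarith
  then have "(\<lambda>n. log 2 (?N n) / real n) \<longlonglongrightarrow> \<alpha>"
    using c C by (intro tendsto_log_growth_rate[of c C]) auto
  then have "(\<lambda>n. ereal (log 2 (?N n) / real n)) \<longlonglongrightarrow> ereal \<alpha>" by simp
  then show ?thesis unfolding topological_entropy_def by (intro lim_imp_Limsup) simp_all
qed

lemma parry_tree: "parry G last = (vertex_prob, edge_prob)"
  unfolding parry_def
proof (rule the_equality)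
  show "case (vertex_prob, edge_prob) of (p, q) \<Rightarrow> max_entropy G last p q"
    by (simp add: max_entropy_def graph_measure_tree graph_entropy_tree topological_entropy_tree)
  fix x assume "case x of (p, q) \<Rightarrow> max_entropy G last p q"
  then show "x = (vertex_prob, edge_prob)"
    using max_entropy_unique by (cases x) (auto simp: max_entropy_def topological_entropy_tree)
qed

section \<open>The path set is the fractal tree\<close>

text \<open>The labels read since the last visit to the root spell the current vertex, and those read
before are complete codewords.\<close>

lemma path_labels_decompose:
  assumes "v \<in> T - S" "path_from v es"
  shows "\<exists>ts\<in>lists S. \<exists>u\<in>T - S. v @ map last es = concat ts @ u"
  using assms
proof (induction es arbitrary: v)
  case Nil
  then show ?case by (intro bexI[of _ "[]"] bexI[of _ v]) auto
next
  case (Cons e es)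
  then have e: "e \<in> T - {[]}" "butlast e = v" and es: "path_from (head G e) es" by auto
  have "e = v @ [last e]" using e by auto
  then have eq: "v @ map last (e # es) = e @ map last es" by (metis append.assoc append_Cons append_Nil list.simps(9))
  obtain ts u where tu: "ts \<in> lists S" "u \<in> T - S" "head G e @ map last es = concat ts @ u"
    using Cons.IH[OF head_in_verts[OF e(1)] es] by auto
  show ?case
  proof (cases "e \<in> S")
    case True
    then have "e @ map last es = concat (e # ts) @ u" using tu(3) by simp
    moreover have "e # ts \<in> lists S" using True tu(1) by simp
    ultimately show ?thesis unfolding eq using tu(2) by blast
  next
    case False
    then show ?thesis unfolding eq using tu by auto
  qed
qed

text \<open>Unique decoding: two parsings of a string into codewords agree as long as both go on, so a
non-terminal remainder \<open>u\<close> can only be continued inside the tree.\<close>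

lemma unfinished_codeword_extends:
  assumes "ts \<in> lists S" "ts' \<in> lists S" "u \<in> T - S" "prefix (concat ts @ u @ [a]) (concat ts')"
  shows "u @ [a] \<in> T"
  using assms
proof (induction ts arbitrary: ts' rule: list.induct)
  case Nil
  then obtain t rest where ts': "ts' = t # rest" by (cases ts') auto
  then have "t \<in> S" using Nil.prems by simp
  have "prefix (u @ [a]) (t @ concat rest)" "prefix t (t @ concat rest)"
    using Nil.prems ts' by simp_all
  then consider "prefix (u @ [a]) t" | "prefix t (u @ [a])"
    using prefix_same_cases by blast
  then show ?case
  proof cases
    case 1
    then show ?thesis using T_prefix_closed S_sub_T[OF \<open>t \<in> S\<close>] by blast
  next
    case 2
    then have "t = u @ [a] \<or> prefix t u" by (simp only: prefix_snoc)
    then show ?thesis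
      using terminal_maximal[OF \<open>t \<in> S\<close>, of u] Nil.prems(3) S_sub_T \<open>t \<in> S\<close> by auto
  qed
next
  case (Cons t ts)
  then obtain t' rest where ts': "ts' = t' # rest" by (cases ts') auto
  have "prefix (t @ concat ts @ u @ [a]) (t' @ concat rest)" using Cons.prems(4) ts' by simp
  moreover from this have "prefix t (t' @ concat rest)" by (rule append_prefixD)
  then have "prefix t t' \<or> prefix t' t" using prefix_same_cases[of t _ t'] by auto
  then have "t = t'" using prefix_freeD[of t t'] prefix_freeD[of t' t] Cons.prems ts' by auto
  ultimately have "prefix (concat ts @ u @ [a]) (concat rest)" by simp
  then show ?case using Cons.IH[of rest] Cons.prems ts' by simp
qed

text \<open>For the inclusion of the fractal tree in the path set, the walk is found by following the
labels through the tree and jumping to the root at each terminal node; unique decoding shows that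
the walk never leaves the tree.\<close>

lemma path_set_tree: "path_set G last [] = fractal_tree m S"
proof (intro equalityI subsetI)
  fix x assume "x \<in> path_set G last []"
  then obtain \<omega> where \<omega>: "\<omega> \<in> inf_walks G" "butlast (shd \<omega>) = []" and x: "x = smap last \<omega>"
    by (auto simp: path_set_def inf_walks_from_def)
  have "last e \<in> \<Sigma> m" if "e \<in> T - {[]}" for e
    using T_lists[of e] that last_in_set[of e] by auto
  then have "x \<in> streams (\<Sigma> m)"
    using \<omega>(1) by (auto simp: x inf_walks_def streams_iff_snth)
  moreover have "stake n x \<in> recursive_tree S" for n
  proof -
    have "path_from [] (stake n \<omega>)" using walk_path_from[OF \<omega>(1)] \<omega>(2) by simp
    then obtain ts u where tu: "ts \<in> lists S" "u \<in> T" "stake n x = concat ts @ u"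
      using path_labels_decompose[of "[]" "stake n \<omega>"] root_nonterminal by (auto simp: x)
    then obtain t where t: "t \<in> S" "prefix u t" by (auto simp: T_eq)
    then have "prefix (stake n x) (concat (ts @ [t]))" using tu(3) by simp
    moreover have "ts @ [t] \<in> lists S" using tu(1) t(1) by simp
    ultimately show ?thesis unfolding recursive_tree_def by blast
  qed
  ultimately show "x \<in> fractal_tree m S" by (simp add: fractal_tree_def)
next
  fix x assume "x \<in> fractal_tree m S"
  then have rec: "stake n x \<in> recursive_tree S" for n by (simp add: fractal_tree_def)
  define st where "st = rec_nat [] (\<lambda>n v. head G (v @ [x !! n]))"
  have st_0: "st 0 = []" and st_Suc: "st (Suc n) = head G (st n @ [x !! n])" for n
    by (simp_all add: st_def)
  have step: "st n @ [x !! n] \<in> T" if "st n \<in> T - S" "ts \<in> lists S" "stake n x = concat ts @ st n" for n ts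
  proof -
    obtain ts' where ts': "ts' \<in> lists S" "prefix (stake (Suc n) x) (concat ts')"
      using rec[of "Suc n"] by (auto simp: recursive_tree_def)
    have "stake (Suc n) x = concat ts @ st n @ [x !! n]"
      using that(3) by (simp add: stake_Suc del: stake.simps)
    then show ?thesis using unfinished_codeword_extends[OF that(2) ts'(1) that(1)] ts'(2) by metis
  qed
  have inv: "st n \<in> T - S \<and> (\<exists>ts\<in>lists S. stake n x = concat ts @ st n)" for n
  proof (induction n)
    case 0
    then show ?case using root_nonterminal by (auto simp: st_0 intro!: bexI[of _ "[]"])
  next
    case (Suc n)
    then obtain ts where ts: "st n \<in> T - S" "ts \<in> lists S" "stake n x = concat ts @ st n" by auto
    have e: "st n @ [x !! n] \<in> T - {[]}" using step[OF ts] by simp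
    have stake: "stake (Suc n) x = concat ts @ st n @ [x !! n]" using ts(3) by (simp add: stake_Suc del: stake.simps)
    have "\<exists>ts\<in>lists S. stake (Suc n) x = concat ts @ st (Suc n)"
    proof (cases "st n @ [x !! n] \<in> S")
      case True
      then show ?thesis using ts(2) unfolding stake st_Suc
        by (intro bexI[of _ "ts @ [st n @ [x !! n]]"]) auto
    next
      case False
      then show ?thesis using ts(2) unfolding stake st_Suc by (intro bexI[of _ ts]) auto
    qed
    then show ?case using head_in_verts[OF e] by (simp only: st_Suc)
  qed
  define \<omega> where "\<omega> = smap (\<lambda>n. st n @ [x !! n]) nats"
  have nth: "\<omega> !! n = st n @ [x !! n]" for n by (simp add: \<omega>_def)
  have "\<omega> \<in> streams (T - {[]})"
    unfolding streams_iff_snth nth using inv step by blast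
  then have "\<omega> \<in> inf_walks G"
    unfolding inf_walks_def nth by (simp add: st_Suc nth del: snth.simps)
  moreover have "tail G (shd \<omega>) = []" using nth[of 0] by (simp add: st_0)
  moreover have "smap last \<omega> = x"
    unfolding \<omega>_def stream.map_comp o_def by (simp add: stream_smap_nats[symmetric])
  ultimately show "x \<in> path_set G last []"
    unfolding path_set_def inf_walks_from_def by blast
qed

section \<open>Conditioning on the start at the root\<close>

abbreviation root_walks :: "nat list stream set" where
  "root_walks \<equiv> inf_walks_from G []"

lemma root_walks_sets: "root_walks \<in> sets walk_space"
proof -
  have eq: "root_walks = {\<omega> \<in> space walk_space. butlast (\<omega> !! 0) = [] \<and>
      (\<forall>n. head G (\<omega> !! n) = butlast (\<omega> !! Suc n))}"
    by (auto simp: inf_walks_from_def inf_walks_def space_stream_space simp del: graph_simps(4))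
  have h [measurable]: "(\<lambda>\<omega>. f (\<omega> !! n)) \<in> measurable walk_space (count_space UNIV)"
    for f :: "nat list \<Rightarrow> nat list" and n
    by (rule measurable_compose[OF measurable_snth]) simp
  show ?thesis unfolding eq by measurable
qed

lemma root_walks_in_space: "root_walks \<subseteq> streams (T - {[]})"
  by (auto simp: inf_walks_from_def inf_walks_def)

text \<open>A walk from the root that follows the branch to \<open>v\<close> is then at \<open>v\<close>, so for \<open>v \<noteq> []\<close> its
continuation does not start at the root.\<close>

lemma stationary_law_root:
  assumes "B \<in> sets walk_space" "B \<subseteq> root_walks"
  shows "stationary_law B = ennreal root_prob * emeasure root_law B"
proof -
  define F where "F v = {\<omega> \<in> streams (T - {[]}). stake (length v) \<omega> = edges v \<and> sdrop (length v) \<omega> \<in> B}" for v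
  have "emeasure root_law (F v) = 0" if v: "v \<in> T - S" "v \<noteq> []" for v
  proof -
    have "coded_walk y \<notin> F v" if y: "y \<in> streams (\<Sigma> k)" for y
    proof
      assume F: "coded_walk y \<in> F v"
      obtain u a where ua: "v = u @ [a]" using v(2) by (cases v rule: rev_cases) auto
      have "stake (length v) (coded_walk y) ! length u = edges v ! length u" using F by (simp add: F_def)
      then have "coded_walk y !! length u = v" by (simp add: ua nth_append del: stake.simps)
      moreover have "head G (coded_walk y !! length u) = tail G (coded_walk y !! length v)"
        using coded_walk_is_walk[OF y] by (simp add: ua inf_walks_from_def inf_walks_def del: graph_simps snth.simps)
      moreover have "tail G (sdrop (length v) (coded_walk y) !! 0) = []"
        using F assms(2) by (auto simp: F_def inf_walks_from_def)
      ultimately show False using v by (simp add: sdrop_snth del: snth.simps)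
    qed
    then have "{y \<in> streams (\<Sigma> k). coded_walk y \<in> F v} = {}" by blast
    moreover have "emeasure root_law (F v) = emeasure code_measure {y \<in> streams (\<Sigma> k). coded_walk y \<in> F v}"
      unfolding F_def by (rule emeasure_root_law[OF continuation_sets[OF v(1) assms(1)]])
    ultimately show ?thesis by (simp only: emeasure_empty)
  qed
  then have "(\<Sum>v\<in>T - S. emeasure root_law (F v)) = (\<Sum>v\<in>{[]}. emeasure root_law (F v))"
    using root_nonterminal by (intro sum.mono_neutral_right) auto
  moreover have "F [] = B"
    using assms(2) root_walks_in_space by (auto simp: F_def)
  ultimately show ?thesis by (simp add: stationary_law_def F_def[symmetric])
qed

lemma conditioned_walk_law:
  defines "R \<equiv> restrict_space stationary_walk root_walks"
  shows "uniform_measure R (space R) = distr code_measure (restrict_space walk_space root_walks) coded_walk"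
    (is "_ = ?D")
proof (rule measure_eqI)
  have space_R: "space R = root_walks"
    using root_walks_in_space by (auto simp: R_def space_restrict_space)
  have sets_R: "sets R = sets (restrict_space walk_space root_walks)"
    unfolding R_def by (rule sets_restrict_space_cong) simp
  show "sets (uniform_measure R (space R)) = sets ?D" using sets_R by simp
  have meas: "coded_walk \<in> measurable code_measure (restrict_space walk_space root_walks)"
    using coded_walk_is_walk by (intro measurable_restrict_space2) auto
  have R: "B \<in> sets walk_space \<and> B \<subseteq> root_walks \<and> emeasure R B = ennreal root_prob * emeasure root_law B"
    if "B \<in> sets R" for B
  proof -
    have B: "B \<in> sets walk_space" "B \<subseteq> root_walks"
      using that root_walks_sets root_walks_in_space
      by (auto simp: sets_R sets_restrict_space_iff space_stream_space Int_absorb2)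
    have "emeasure R B = emeasure stationary_walk B"
      unfolding R_def using B root_walks_sets root_walks_in_space
      by (intro emeasure_restrict_space) (auto simp: Int_absorb2)
    then show ?thesis using B emeasure_stationary_walk[OF B(1)] stationary_law_root[OF B] by simp
  qed
  have "{y \<in> streams (\<Sigma> k). coded_walk y \<in> root_walks} = space code_measure"
    using coded_walk_is_walk by auto
  then have "emeasure root_law root_walks = 1"
    using prob_space.emeasure_space_1[OF prob_space_code_measure]
    by (simp add: emeasure_root_law[OF root_walks_sets])
  then have total: "emeasure R (space R) = ennreal root_prob"
    using R[of "space R"] sets.top[of R] by (simp add: space_R)
  fix B assume "B \<in> sets (uniform_measure R (space R))"
  then have B: "B \<in> sets R" by simp
  have "emeasure (uniform_measure R (space R)) B = emeasure R (space R \<inter> B) / emeasure R (space R)"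
    using B by (intro emeasure_uniform_measure) auto
  also have "space R \<inter> B = B" using sets.sets_into_space[OF B] by blast
  also have "emeasure R B / emeasure R (space R) = emeasure root_law B"
    using R[OF B] root_prob_pos unfolding total
    by (simp add: ennreal_times_divide[symmetric] mult.commute[of "ennreal root_prob"] mult.assoc divide_ennreal)
  also have "\<dots> = emeasure ?D B"
    using R[OF B] B meas unfolding sets_R
    by (subst emeasure_distr) (auto simp: emeasure_root_law intro!: arg_cong[of _ _ "emeasure code_measure"])
  finally show "emeasure (uniform_measure R (space R)) B = emeasure ?D B" .
qed

lemma measurable_labels:
  "smap last \<in> measurable (restrict_space walk_space root_walks) (seq_space m (path_set G last []))"
  unfolding seq_space_def
proof (rule measurable_restrict_space3)
  have "last \<in> T - {[]} \<rightarrow> \<Sigma> m"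
  proof
    fix e assume "e \<in> T - {[]}"
    then show "last e \<in> \<Sigma> m" using T_lists[of e] last_in_set[of e] by auto
  qed
  then have "last \<in> measurable (count_space (T - {[]})) (count_space (\<Sigma> m))"
    by simp
  then show "smap last \<in> measurable walk_space (stream_space (count_space (\<Sigma> m)))"
    by (rule measurable_smap)
  show "smap last \<in> root_walks \<rightarrow> path_set G last []"
    by (auto simp: path_set_def)
qed

lemma parry_path_set_eq_coded:
  "parry_path_set m G last [] = distr code_measure (seq_space m (fractal_tree m S)) (\<Psi> \<tau>)"
proof -
  let ?R = "restrict_space walk_space root_walks" and ?Q = "seq_space m (path_set G last [])"
  have meas: "coded_walk \<in> measurable code_measure ?R"
    using coded_walk_is_walk by (intro measurable_restrict_space2) auto
  have "parry_path_set m G last [] = distr (distr code_measure ?R coded_walk) ?Q (smap last)"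
    unfolding parry_path_set_def parry_tree Let_def conditioned_walk_law ..
  also have "\<dots> = distr code_measure ?Q (smap last \<circ> coded_walk)"
    by (rule distr_distr[OF measurable_labels meas])
  also have "\<dots> = distr code_measure ?Q (\<Psi> \<tau>)"
    using smap_last_coded_walk by (intro distr_cong) simp_all
  finally show ?thesis by (simp only: path_set_tree)
qed

end

section \<open>The Parry measure on the path set\<close>

theorem theorem5p6:
  fixes m k :: nat and S T :: "nat list set" and \<tau> :: "nat \<Rightarrow> nat list"
  assumes "k \<ge> 2"
    and "finite_tree m S T"
    and "bij_betw \<tau> (\<Sigma> k) S"
  shows "parry_path_set m (tree_graph S T) tree_label [] =
         distr (length_measure k (\<lambda>i. length (\<tau> i))) (seq_space m (fractal_tree m S)) (\<Psi> \<tau>)"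
proof -
  interpret tree_code m k S T \<tau> using assms by unfold_locales
  show ?thesis by (rule parry_path_set_eq_coded)
qed

end
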